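(* Let $\pi:A\to H$ be a surjective Hopf algebra map with associated quantum homogeneous space $B:=A^{\mathrm{co}(H)}$, let $(A,\Delta_R,\Omega^1(A))$ be a quantum $H$-principal bundle over $B$, and let $\Omega^1(B)$ be the restriction of $\Omega^1(A)$ to $B$. Assume that (i) $\iota(\Phi(\Omega^1(B)))$ is a subobject of $F(\Omega^1(A))$ in the category $\mathsf{Mod}_A$ of right $A$-modules; (ii) $\Omega^1(B)$ is a finite-dimensional object of ${}^A_B\mathsf{Mod}_0$. Then: (a) for a bicovariant splitting map $i:H\to A$ of $\pi$, a right $H$-action on $\Phi(\Omega^1(B))$ is defined by $$\triangleleft:\Phi(\Omega^1(B))\otimes H\to\Phi(\Omega^1(B)),\qquad [b]\otimes h\mapsto [b]\triangleleft_A i(h)=[b\,i(h)],$$ where $\triangleleft_A$ is the right $A$-action on $\iota(\Phi(\Omega^1(B)))$; (b) the triple $(\Phi(\Omega^1(B)),\triangleleft,\mathrm{Ad}_\pi)$ is a Yetter--Drinfeld module over $H$; (c) this Yetter--Drinfeld module structure is independent of the choice of bicovariant splitting map $i$.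
   Context: All Hopf algebras are over $\mathbb{C}$ with bijective antipode; Sweedler notation is used; $a^+:=a-\varepsilon(a)1$, and $W^+:=W\cap\ker\varepsilon$ for a subspace $W$ of a Hopf algebra. Quantum homogeneous space. $\Delta_R:=(\mathrm{id}\otimes\pi)\circ\Delta:A\to A\otimes H$ and $B=A^{\mathrm{co}(H)}=\{a:\Delta_R(a)=a\otimes1\}$; it is always assumed that $A$ is faithfully flat as a right $B$-module. $\Delta$ restricts to a left $A$-coaction on $B$. Splitting map. A (strong) bicovariant splitting map is a unital linear map $i:H\to A$ with $\pi\circ i=\mathrm{id}_H$, $(i\otimes\mathrm{id})\circ\Delta=(\mathrm{id}\otimes\pi)\circ\Delta\circ i$ and $(\mathrm{id}\otimes i)\circ\Delta=(\pi\otimes\mathrm{id})\circ\Delta\circ i$. Calculi. A first-order differential calculus over an algebra $P$ is a $P$-bimodule $\Omega^1(P)$ with a linear $\mathrm{d}:P\to\Omega^1(P)$ satisfying the Leibniz rule, with $\Omega^1(P)$ generated as a left $P$-module by $\mathrm{d}P$. The universal one is $\Omega^1_u(P)=\ker(P\otimes P\to P)$, $\mathrm{d}_ub=1\otimes b-b\otimes1$, and every calculus is $\Omega^1_u(P)/N$ for a sub-bimodule $N$. It is left (resp. right) covariant for a comodule algebra structure on $P$ if the coaction extends to $\Omega^1(P)$ with $\Delta_L(b\,\mathrm{d}b')=\Delta_L(b)(\mathrm{id}\otimes\mathrm{d})\Delta_L(b')$ (resp. analogously on the right). Quantum principal bundle over $B$. This means that $A$ is an $H$-Hopf--Galois extension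 of $B$ (the map $A\otimes_BA\to A\otimes H$, $a'\otimes a\mapsto a'a_{(1)}\otimes\pi(a_{(2)})$ is bijective), and $\Omega^1(A)=\Omega^1_u(A)/N$ is a left $A$-covariant, right $H$-covariant first-order calculus with $\mathrm{ver}(N)=A\otimes I$ for a right ideal $I\subseteq H^+$ satisfying $\mathrm{Ad}_H(I)\subseteq I\otimes H$; here $\mathrm{ver}(a'\mathrm{d}a)=a'a_{(1)}\otimes\pi(a_{(2)}^+)$ and $\mathrm{Ad}_H(h)=h_{(2)}\otimes S(h_{(1)})h_{(3)}$. The restriction $\Omega^1(B)$ of $\Omega^1(A)$ is the span of the $a\,\mathrm{d}b$, $a,b\in B$, inside $\Omega^1(A)$. Functors. ${}^A_B\mathsf{Mod}_B$ is the category of $B$-bimodules with a compatible left $A$-coaction ($\Delta_L(bfc)=\Delta(b)\Delta_L(f)\Delta(c)$). $\Phi(\mathcal{F}):=\mathcal{F}/B^+\mathcal{F}$ for $\mathcal{F}\in{}^A_B\mathsf{Mod}_B$, and $\mathcal{F}$ is finite-dimensional if $\Phi(\mathcal{F})$ is. ${}^A_B\mathsf{Mod}_0$ is the full subcategory of objects with $B^+\mathcal{F}=\mathcal{F}B^+$. For $\mathcal F\in {}^A_A\mathsf{Mod}_A$, $F(\mathcal{F}):=\mathcal{F}/A^+\mathcal{F}$, a right $A$-module. Identifications. $[a\,\mathrm{d}b]\mapsto\varepsilon(a)b^+$ identifies $F(\Omega^1(A))$ with $A^+/I_A$, for a right ideal $I_A\subseteq A^+$ (the $A$-action is right multiplication),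 and $\Phi(\Omega^1(B))$ with $B^+/I_B$, $I_B=I_A\cap B^+$. $\iota:B^+/I_B\to A^+/I_A$ is the evident inclusion; $\Phi(\Omega^1(B))$ is identified with its image, and $[\cdot]$ denotes classes. Coaction. $\mathrm{Ad}_\pi:\Phi(\Omega^1(B))\to\Phi(\Omega^1(B))\otimes H$, $\mathrm{Ad}_\pi[b]=[b_{(2)}]\otimes\pi(S(b_{(1)}))$ for $b\in B^+$. Yetter--Drinfeld module over $H$: a right $H$-module and right $H$-comodule $V$ with $v_{(0)}\triangleleft h_{(1)}\otimes v_{(1)}h_{(2)}=(v\triangleleft h_{(2)})_{(0)}\otimes h_{(1)}(v\triangleleft h_{(2)})_{(1)}$ for all $v\in V$, $h\in H$. *)

theory Defs
  imports Complex_Main "HOL-Library.Poly_Mapping"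
begin

section \<open>Complex vector spaces and algebras\<close>

class scaleC =
  fixes scaleC :: "complex \<Rightarrow> 'a \<Rightarrow> 'a"  (infixr \<open>*\<^sub>C\<close> 75)

class complex_vector = scaleC + ab_group_add +
  assumes scaleC_add_right: "c *\<^sub>C (x + y) = c *\<^sub>C x + c *\<^sub>C y"
    and scaleC_add_left: "(c + e) *\<^sub>C x = c *\<^sub>C x + e *\<^sub>C x"
    and scaleC_scaleC: "c *\<^sub>C e *\<^sub>C x = (c * e) *\<^sub>C x"
    and scaleC_one: "1 *\<^sub>C x = x"

class complex_algebra_1 = complex_vector + ring_1 +
  assumes mult_scaleC_left: "(c *\<^sub>C x) * y = c *\<^sub>C (x * y)"
    and mult_scaleC_right: "x * (c *\<^sub>C y) = c *\<^sub>C (x * y)"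

global_interpretation complex_vector: vector_space "scaleC :: complex \<Rightarrow> 'a \<Rightarrow> 'a::complex_vector"
  defines csubspace = complex_vector.subspace
    and cspan = complex_vector.span
  by unfold_locales (simp_all add: scaleC_add_right scaleC_add_left scaleC_scaleC scaleC_one)

abbreviation clinear :: "('a::complex_vector \<Rightarrow> 'b::complex_vector) \<Rightarrow> bool"
  where "clinear \<equiv> Vector_Spaces.linear scaleC scaleC"

definition cbilinear :: "('a::complex_vector \<Rightarrow> 'b::complex_vector \<Rightarrow> 'c::complex_vector) \<Rightarrow> bool"
  where "cbilinear f \<longleftrightarrow> (\<forall>x. clinear (f x)) \<and> (\<forall>y. clinear (\<lambda>x. f x y))"

lemma clinearI:
  assumes "\<And>x y. f (x + y) = f x + f y" and "\<And>c x. f (c *\<^sub>C x) = c *\<^sub>C f x"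
  shows "clinear f"
  by unfold_locales (use assms in auto)

lemma clinear_add: "clinear f \<Longrightarrow> f (x + y) = f x + f y"
  and clinear_scale: "clinear f \<Longrightarrow> f (c *\<^sub>C x) = c *\<^sub>C f x"
  by (simp_all add: Vector_Spaces.linear_iff)

instantiation complex :: complex_algebra_1
begin

definition scaleC_complex :: "complex \<Rightarrow> complex \<Rightarrow> complex"
  where "scaleC_complex = (*)"

instance
  by standard (simp_all add: scaleC_complex_def algebra_simps)

end

instantiation poly_mapping :: (type, complex_vector) complex_vector
begin

definition scaleC_poly_mapping :: "complex \<Rightarrow> ('a \<Rightarrow>\<^sub>0 'b) \<Rightarrow> 'a \<Rightarrow>\<^sub>0 'b"
  where "scaleC_poly_mapping c = Poly_Mapping.map (scaleC c)"

lemma lookup_scaleC: "Poly_Mapping.lookup (c *\<^sub>C p) k = c *\<^sub>C Poly_Mapping.lookup p k"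
  by (simp add: scaleC_poly_mapping_def Poly_Mapping.map.rep_eq "when_def")

instance
  by standard
    (rule poly_mapping_eqI,
      simp add: lookup_scaleC lookup_add scaleC_add_right scaleC_add_left scaleC_scaleC scaleC_one)+

end


section \<open>Tensor products over the complex numbers\<close>

text \<open>The free vector space on pairs, modulo the bilinearity relations.\<close>

definition tensor_relations :: "(('a::complex_vector \<times> 'b::complex_vector) \<Rightarrow>\<^sub>0 complex) set"
  where "tensor_relations =
    {Poly_Mapping.single (x + x', y) 1 - Poly_Mapping.single (x, y) 1
       - Poly_Mapping.single (x', y) 1 | x x' y. True} \<union>
    {Poly_Mapping.single (x, y + y') 1 - Poly_Mapping.single (x, y) 1
       - Poly_Mapping.single (x, y') 1 | x y y'. True} \<union>
    {Poly_Mapping.single (c *\<^sub>C x, y) 1 - c *\<^sub>C Poly_Mapping.single (x, y) 1 | c x y. True} \<union>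
    {Poly_Mapping.single (x, c *\<^sub>C y) 1 - c *\<^sub>C Poly_Mapping.single (x, y) 1 | c x y. True}"

definition tensor_rel ::
    "(('a::complex_vector \<times> 'b::complex_vector) \<Rightarrow>\<^sub>0 complex) \<Rightarrow> (('a \<times> 'b) \<Rightarrow>\<^sub>0 complex) \<Rightarrow> bool"
  where "tensor_rel p q \<longleftrightarrow> p - q \<in> cspan tensor_relations"

lemma equivp_tensor_rel:
  "equivp (tensor_rel :: (('a::complex_vector \<times> 'b::complex_vector) \<Rightarrow>\<^sub>0 complex) \<Rightarrow> _)"
proof (rule equivpI)
  show "reflp (tensor_rel :: (('a \<times> 'b) \<Rightarrow>\<^sub>0 complex) \<Rightarrow> _)"
    by (simp add: reflp_def tensor_rel_def complex_vector.span_zero)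
  show "symp (tensor_rel :: (('a \<times> 'b) \<Rightarrow>\<^sub>0 complex) \<Rightarrow> _)"
  proof (rule sympI)
    fix p q :: "('a \<times> 'b) \<Rightarrow>\<^sub>0 complex" assume "tensor_rel p q"
    then show "tensor_rel q p"
      using complex_vector.span_neg[of "p - q" tensor_relations] by (simp add: tensor_rel_def)
  qed
  show "transp (tensor_rel :: (('a \<times> 'b) \<Rightarrow>\<^sub>0 complex) \<Rightarrow> _)"
  proof (rule transpI)
    fix p q r :: "('a \<times> 'b) \<Rightarrow>\<^sub>0 complex" assume "tensor_rel p q" "tensor_rel q r"
    then show "tensor_rel p r"
      using complex_vector.span_add[of "p - q" tensor_relations "q - r"] by (simp add: tensor_rel_def)
  qed
qed

quotient_type (overloaded) ('a, 'b) tensor (infixr \<open>\<otimes>\<close> 70) =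
    "('a::complex_vector \<times> 'b::complex_vector) \<Rightarrow>\<^sub>0 complex" / tensor_rel
  by (rule equivp_tensor_rel)

lemma diff_diff_diff: "(a - b) - (c - e) = (a - c) - (b - e)" for a :: "'a::ab_group_add"
  by simp

instantiation tensor :: (complex_vector, complex_vector) complex_vector
begin

lift_definition zero_tensor :: "'a \<otimes> 'b" is 0 .

lift_definition plus_tensor :: "'a \<otimes> 'b \<Rightarrow> 'a \<otimes> 'b \<Rightarrow> 'a \<otimes> 'b" is "(+)"
  unfolding tensor_rel_def by (subst add_diff_add) (rule complex_vector.span_add)

lift_definition uminus_tensor :: "'a \<otimes> 'b \<Rightarrow> 'a \<otimes> 'b" is uminus
  unfolding tensor_rel_def by (subst minus_diff_minus) (rule complex_vector.span_neg)

lift_definition minus_tensor :: "'a \<otimes> 'b \<Rightarrow> 'a \<otimes> 'b \<Rightarrow> 'a \<otimes> 'b" is "(-)"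
  unfolding tensor_rel_def by (subst diff_diff_diff) (rule complex_vector.span_diff)

lift_definition scaleC_tensor :: "complex \<Rightarrow> 'a \<otimes> 'b \<Rightarrow> 'a \<otimes> 'b" is scaleC
  unfolding tensor_rel_def
  by (subst complex_vector.scale_right_diff_distrib[symmetric]) (rule complex_vector.span_scale)

instance
proof
  fix x y z :: "'a \<otimes> 'b" and c e :: complex
  have refl: "tensor_rel p p" for p :: "('a \<times> 'b) \<Rightarrow>\<^sub>0 complex"
    by (simp add: tensor_rel_def complex_vector.span_zero)
  show "x + y + z = x + (y + z)" by transfer (simp add: add.assoc refl)
  show "x + y = y + x" by transfer (simp add: add.commute refl)
  show "0 + x = x" by transfer (simp add: refl)
  show "- x + x = 0" by transfer (simp add: refl)
  show "x - y = x + - y" by transfer (simp add: refl)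
  show "c *\<^sub>C (x + y) = c *\<^sub>C x + c *\<^sub>C y" by transfer (simp add: scaleC_add_right refl)
  show "(c + e) *\<^sub>C x = c *\<^sub>C x + e *\<^sub>C x" by transfer (simp add: scaleC_add_left refl)
  show "c *\<^sub>C e *\<^sub>C x = (c * e) *\<^sub>C x" by transfer (simp add: scaleC_scaleC refl)
  show "1 *\<^sub>C x = x" by transfer (simp add: scaleC_one refl)
qed

end

lift_definition tensor_of :: "'a::complex_vector \<Rightarrow> 'b::complex_vector \<Rightarrow> 'a \<otimes> 'b"  (infixr \<open>\<otimes>\<close> 70)
  is "\<lambda>x y. Poly_Mapping.single (x, y) 1" .

text \<open>The linear map induced by a bilinear map: for \<open>t = (\<Sum>k. x\<^sub>k \<otimes> y\<^sub>k)\<close> the value of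
  \<open>tensor_sum t f\<close> is \<open>(\<Sum>k. f x\<^sub>k y\<^sub>k)\<close>. It is only meaningful for bilinear \<open>f\<close>, see the lemmas below.
  In particular \<open>tensor_sum (comult a) (\<lambda>a1 a2. f a1 a2)\<close> renders Sweedler notation.\<close>

definition free_sum ::
    "(('a \<times> 'b) \<Rightarrow>\<^sub>0 complex) \<Rightarrow> ('a \<Rightarrow> 'b \<Rightarrow> 'c::complex_vector) \<Rightarrow> 'c"
  where "free_sum p f = (\<Sum>k\<in>Poly_Mapping.keys p. Poly_Mapping.lookup p k *\<^sub>C f (fst k) (snd k))"

definition tensor_sum ::
    "'a::complex_vector \<otimes> 'b::complex_vector \<Rightarrow> ('a \<Rightarrow> 'b \<Rightarrow> 'c::complex_vector) \<Rightarrow> 'c"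
  where "tensor_sum t f = free_sum (rep_tensor t) f"

lemma free_sum_superset:
  assumes "finite K" "Poly_Mapping.keys p \<subseteq> K"
  shows "free_sum p f = (\<Sum>k\<in>K. Poly_Mapping.lookup p k *\<^sub>C f (fst k) (snd k))"
  unfolding free_sum_def
  by (rule sum.mono_neutral_left) (use assms in \<open>auto simp: in_keys_iff\<close>)

lemma clinear_free_sum: "clinear (\<lambda>p. free_sum p f)"
proof (rule clinearI)
  fix p q :: "('a \<times> 'b) \<Rightarrow>\<^sub>0 complex" and c :: complex
  let ?K = "Poly_Mapping.keys p \<union> Poly_Mapping.keys q"
  have "free_sum (p + q) f = (\<Sum>k\<in>?K. Poly_Mapping.lookup (p + q) k *\<^sub>C f (fst k) (snd k))"
    by (rule free_sum_superset) (simp_all add: Poly_Mapping.keys_add)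
  also have "\<dots> = free_sum p f + free_sum q f"
    by (simp add: lookup_add scaleC_add_left sum.distrib free_sum_superset[of ?K])
  finally show "free_sum (p + q) f = free_sum p f + free_sum q f" .
  have "free_sum (c *\<^sub>C p) f
      = (\<Sum>k\<in>Poly_Mapping.keys p. Poly_Mapping.lookup (c *\<^sub>C p) k *\<^sub>C f (fst k) (snd k))"
    by (rule free_sum_superset)
      (auto simp: in_keys_iff lookup_scaleC scaleC_complex_def)
  then show "free_sum (c *\<^sub>C p) f = c *\<^sub>C free_sum p f"
    by (simp add: free_sum_def lookup_scaleC scaleC_complex_def scaleC_scaleC
        complex_vector.scale_sum_right)
qed

lemma free_sum_single: "free_sum (Poly_Mapping.single (x, y) 1) f = f x y"
  by (simp add: free_sum_def scaleC_one)

lemma free_sum_cong_rel: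
  assumes f: "cbilinear f" and pq: "tensor_rel p q"
  shows "free_sum p f = free_sum q f"
proof -
  interpret L: Vector_Spaces.linear scaleC scaleC "\<lambda>p. free_sum p f"
    by (rule clinear_free_sum)
  have l1: "f (x + x') y = f x y + f x' y" "f (c *\<^sub>C x) y = c *\<^sub>C f x y" for x x' y c
    using f clinear_add[of "\<lambda>x. f x y"] clinear_scale[of "\<lambda>x. f x y"]
    by (auto simp: cbilinear_def)
  have l2: "f x (y + y') = f x y + f x y'" "f x (c *\<^sub>C y) = c *\<^sub>C f x y" for x y y' c
    using f clinear_add[of "f x"] clinear_scale[of "f x"] by (auto simp: cbilinear_def)
  have "free_sum r f = 0" if "r \<in> tensor_relations" for r
    using that unfolding tensor_relations_def
    by (auto simp: L.diff L.scale free_sum_single l1 l2)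
  then have "free_sum (p - q) f = 0"
    using pq L.eq_0_on_span[of "tensor_relations" "p - q"] by (auto simp: tensor_rel_def cspan_def)
  then show ?thesis by (simp add: L.diff)
qed

lemma rep_abs_tensor_rel: "tensor_rel (rep_tensor (abs_tensor p)) p"
  by (rule Quotient3_rep_abs[OF Quotient3_tensor]) (simp add: tensor_rel_def complex_vector.span_zero)

lemma tensor_sum_abs: "cbilinear f \<Longrightarrow> tensor_sum (abs_tensor p) f = free_sum p f"
  unfolding tensor_sum_def by (rule free_sum_cong_rel) (auto intro: rep_abs_tensor_rel)

lemma tensor_sum_tensor_of: "cbilinear f \<Longrightarrow> tensor_sum (x \<otimes> y) f = f x y"
  by (simp add: tensor_of.abs_eq tensor_sum_abs free_sum_single)

lemma clinear_tensor_sum: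
  assumes "cbilinear f"
  shows "clinear (\<lambda>t. tensor_sum t f)"
proof (rule clinearI)
  fix s t :: "'a \<otimes> 'b" and c :: complex
  obtain p q where pq: "s = abs_tensor p" "t = abs_tensor q"
    by (metis Quotient3_abs_rep[OF Quotient3_tensor])
  show "tensor_sum (s + t) f = tensor_sum s f + tensor_sum t f"
    using assms by (simp add: pq plus_tensor.abs_eq tensor_sum_abs clinear_add[OF clinear_free_sum])
  show "tensor_sum (c *\<^sub>C s) f = c *\<^sub>C tensor_sum s f"
    using assms by (simp add: pq scaleC_tensor.abs_eq tensor_sum_abs clinear_scale[OF clinear_free_sum])
qed

definition tensor_map ::
    "('a::complex_vector \<Rightarrow> 'c::complex_vector) \<Rightarrow> ('b::complex_vector \<Rightarrow> 'e::complex_vector)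
      \<Rightarrow> 'a \<otimes> 'b \<Rightarrow> 'c \<otimes> 'e"
  where "tensor_map f g t = tensor_sum t (\<lambda>x y. f x \<otimes> g y)"

definition tensor_assoc ::
    "('a::complex_vector \<otimes> 'b::complex_vector) \<otimes> 'c::complex_vector \<Rightarrow> 'a \<otimes> 'b \<otimes> 'c"
  where "tensor_assoc t = tensor_sum t (\<lambda>s z. tensor_sum s (\<lambda>x y. x \<otimes> y \<otimes> z))"

text \<open>The image of \<open>X \<otimes> Y\<close> in the ambient tensor product, for subspaces \<open>X\<close> and \<open>Y\<close>.\<close>

definition tensor_subspace ::
    "'a::complex_vector set \<Rightarrow> 'b::complex_vector set \<Rightarrow> ('a \<otimes> 'b) set"
  where "tensor_subspace X Y = cspan {x \<otimes> y | x y. x \<in> X \<and> y \<in> Y}"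


section \<open>Hopf algebras\<close>

class hopf_algebra =
  fixes comult :: "'a::complex_algebra_1 \<Rightarrow> 'a \<otimes> 'a"
    and counit :: "'a \<Rightarrow> complex"
    and antipode :: "'a \<Rightarrow> 'a"
  assumes clinear_comult: "clinear comult"
    and clinear_counit: "clinear counit"
    and clinear_antipode: "clinear antipode"
    and coassoc: "tensor_assoc (tensor_map comult id (comult a)) = tensor_map id comult (comult a)"
    and counit_left: "tensor_sum (comult a) (\<lambda>a1 a2. counit a1 *\<^sub>C a2) = a"
    and counit_right: "tensor_sum (comult a) (\<lambda>a1 a2. counit a2 *\<^sub>C a1) = a"
    and comult_one: "comult 1 = 1 \<otimes> 1"
    and comult_mult: "comult (a * b) =
          tensor_sum (comult a) (\<lambda>a1 a2. tensor_sum (comult b) (\<lambda>b1 b2. (a1 * b1) \<otimes> (a2 * b2)))"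
    and counit_one: "counit 1 = 1"
    and counit_mult: "counit (a * b) = counit a * counit b"
    and antipode_left: "tensor_sum (comult a) (\<lambda>a1 a2. antipode a1 * a2) = counit a *\<^sub>C 1"
    and antipode_right: "tensor_sum (comult a) (\<lambda>a1 a2. a1 * antipode a2) = counit a *\<^sub>C 1"

text \<open>\<open>aug a\<close> is \<open>a\<^sup>+\<close> and \<open>aug_part W\<close> is \<open>W\<^sup>+\<close>.\<close>

definition aug :: "'a::hopf_algebra \<Rightarrow> 'a"
  where "aug a = a - counit a *\<^sub>C 1"

definition aug_part :: "'a::hopf_algebra set \<Rightarrow> 'a set"
  where "aug_part W = {w \<in> W. counit w = 0}"

definition hopf_algebra_hom :: "('a::hopf_algebra \<Rightarrow> 'h::hopf_algebra) \<Rightarrow> bool"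
  where "hopf_algebra_hom \<pi> \<longleftrightarrow> clinear \<pi> \<and> \<pi> 1 = 1 \<and> (\<forall>a b. \<pi> (a * b) = \<pi> a * \<pi> b) \<and>
    (\<forall>a. comult (\<pi> a) = tensor_map \<pi> \<pi> (comult a)) \<and> (\<forall>a. counit (\<pi> a) = counit a) \<and>
    (\<forall>a. antipode (\<pi> a) = \<pi> (antipode a))"

definition adjoint_coaction :: "'h::hopf_algebra \<Rightarrow> 'h \<otimes> 'h"
  where "adjoint_coaction h = tensor_sum (comult h)
    (\<lambda>h' h3. tensor_sum (comult h') (\<lambda>h1 h2. h2 \<otimes> (antipode h1 * h3)))"

definition right_ideal :: "'h::hopf_algebra set \<Rightarrow> bool"
  where "right_ideal I \<longleftrightarrow> csubspace I \<and> (\<forall>x\<in>I. \<forall>h. x * h \<in> I)"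

definition left_coaction :: "('v::complex_vector \<Rightarrow> 'a::hopf_algebra \<otimes> 'v) \<Rightarrow> bool"
  where "left_coaction \<delta> \<longleftrightarrow> clinear \<delta> \<and>
    (\<forall>v. tensor_assoc (tensor_map comult id (\<delta> v)) = tensor_map id \<delta> (\<delta> v)) \<and>
    (\<forall>v. tensor_sum (\<delta> v) (\<lambda>a w. counit a *\<^sub>C w) = v)"

definition right_coaction :: "('v::complex_vector \<Rightarrow> 'v \<otimes> 'h::hopf_algebra) \<Rightarrow> bool"
  where "right_coaction \<rho> \<longleftrightarrow> clinear \<rho> \<and>
    (\<forall>v. tensor_assoc (tensor_map \<rho> id (\<rho> v)) = tensor_map id comult (\<rho> v)) \<and>
    (\<forall>v. tensor_sum (\<rho> v) (\<lambda>w h. counit h *\<^sub>C w) = v)"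

definition right_action :: "('v::complex_vector \<Rightarrow> 'h::hopf_algebra \<Rightarrow> 'v) \<Rightarrow> bool"
  where "right_action act \<longleftrightarrow> cbilinear act \<and> (\<forall>v. act v 1 = v) \<and>
    (\<forall>v h k. act (act v h) k = act v (h * k))"

definition yetter_drinfeld ::
    "('v::complex_vector \<Rightarrow> 'h::hopf_algebra \<Rightarrow> 'v) \<Rightarrow> ('v \<Rightarrow> 'v \<otimes> 'h) \<Rightarrow> bool"
  where "yetter_drinfeld act \<rho> \<longleftrightarrow> right_action act \<and> right_coaction \<rho> \<and>
    (\<forall>v h. tensor_sum (\<rho> v) (\<lambda>v0 v1. tensor_sum (comult h) (\<lambda>h1 h2. act v0 h1 \<otimes> (v1 * h2))) =
           tensor_sum (comult h) (\<lambda>h1 h2. tensor_sum (\<rho> (act v h2)) (\<lambda>w0 w1. w0 \<otimes> (h1 * w1))))"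


section \<open>Quantum homogeneous spaces\<close>

definition coact_R :: "('a::hopf_algebra \<Rightarrow> 'h::hopf_algebra) \<Rightarrow> 'a \<Rightarrow> 'a \<otimes> 'h"
  where "coact_R \<pi> a = tensor_map id \<pi> (comult a)"

definition coinvariants :: "('a::hopf_algebra \<Rightarrow> 'h::hopf_algebra) \<Rightarrow> 'a set"
  where "coinvariants \<pi> = {a. coact_R \<pi> a = a \<otimes> 1}"

text \<open>Left modules over a subalgebra \<open>B\<close> are subspaces \<open>M\<close> of an ambient vector space with an action
  that only matters on \<open>B \<times> M\<close>.\<close>

definition left_module_on ::
    "'a::hopf_algebra set \<Rightarrow> 'm::complex_vector set \<Rightarrow> ('a \<Rightarrow> 'm \<Rightarrow> 'm) \<Rightarrow> bool"
  where "left_module_on B M act \<longleftrightarrow> csubspace M \<and>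
    (\<forall>b\<in>B. \<forall>m\<in>M. act b m \<in> M) \<and>
    (\<forall>b\<in>B. \<forall>m\<in>M. \<forall>n\<in>M. act b (m + n) = act b m + act b n) \<and>
    (\<forall>b\<in>B. \<forall>c\<in>B. \<forall>m\<in>M. act (b + c) m = act b m + act c m) \<and>
    (\<forall>b\<in>B. \<forall>c\<in>B. \<forall>m\<in>M. act (b * c) m = act b (act c m)) \<and>
    (\<forall>z. \<forall>m\<in>M. act (z *\<^sub>C 1) m = z *\<^sub>C m)"

text \<open>Every linear map between subspaces extends linearly, so module maps may be taken to be linear on
  the ambient space.\<close>

definition left_module_hom_on ::
    "'a::hopf_algebra set \<Rightarrow> 'm::complex_vector set \<Rightarrow> ('a \<Rightarrow> 'm \<Rightarrow> 'm)
      \<Rightarrow> 'n::complex_vector set \<Rightarrow> ('a \<Rightarrow> 'n \<Rightarrow> 'n) \<Rightarrow> ('m \<Rightarrow> 'n) \<Rightarrow> bool"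
  where "left_module_hom_on B M actM N actN f \<longleftrightarrow> clinear f \<and> f ` M \<subseteq> N \<and>
    (\<forall>b\<in>B. \<forall>m\<in>M. f (actM b m) = actN b (f m))"

text \<open>\<open>A \<otimes>\<^sub>B M\<close> is \<open>tensor_subspace UNIV M\<close> modulo \<open>balanced B M act\<close>.\<close>

definition balanced ::
    "'a::hopf_algebra set \<Rightarrow> 'm::complex_vector set \<Rightarrow> ('a \<Rightarrow> 'm \<Rightarrow> 'm) \<Rightarrow> ('a \<otimes> 'm) set"
  where "balanced B M act = cspan {(a * b) \<otimes> m - a \<otimes> act b m | a b m. b \<in> B \<and> m \<in> M}"

text \<open>\<open>A\<close> is a faithfully flat right \<open>B\<close>-module: a sequence \<open>L \<rightarrow> M \<rightarrow> N\<close> of left \<open>B\<close>-modules is exact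
  at \<open>M\<close> if and only if \<open>A \<otimes>\<^sub>B L \<rightarrow> A \<otimes>\<^sub>B M \<rightarrow> A \<otimes>\<^sub>B N\<close> is exact at \<open>A \<otimes>\<^sub>B M\<close>. The modules range
  over all subspaces of the vector space with basis \<open>A\<close>, that is, up to isomorphism over all
  \<open>B\<close>-modules whose dimension is at most the cardinality of \<open>A\<close>. This is no restriction: \<open>A\<close> is
  infinite and contains \<open>B\<close>, so all cyclic modules are included and any failure of exactness is
  already visible on submodules generated by at most \<open>card A\<close> elements.\<close>

definition faithfully_flat :: "'a::hopf_algebra set \<Rightarrow> bool"
  where "faithfully_flat B \<longleftrightarrow>
    (\<forall>(L :: ('a \<Rightarrow>\<^sub>0 complex) set) (M :: ('a \<Rightarrow>\<^sub>0 complex) set) (N :: ('a \<Rightarrow>\<^sub>0 complex) set)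
        actL actM actN f g.
      left_module_on B L actL \<and> left_module_on B M actM \<and> left_module_on B N actN \<and>
      left_module_hom_on B L actL M actM f \<and> left_module_hom_on B M actM N actN g \<longrightarrow>
      ((\<forall>m\<in>M. g m = 0 \<longleftrightarrow> m \<in> f ` L) \<longleftrightarrow>
       (\<forall>t\<in>tensor_subspace UNIV M. tensor_map id g t \<in> balanced B N actN \<longleftrightarrow>
          (\<exists>s\<in>tensor_subspace UNIV L. t - tensor_map id f s \<in> balanced B M actM))))"

definition bicovariant_splitting ::
    "('a::hopf_algebra \<Rightarrow> 'h::hopf_algebra) \<Rightarrow> ('h \<Rightarrow> 'a) \<Rightarrow> bool"
  where "bicovariant_splitting \<pi> i \<longleftrightarrow> clinear i \<and> i 1 = 1 \<and> \<pi> \<circ> i = id \<and>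
    tensor_map i id \<circ> comult = tensor_map id \<pi> \<circ> comult \<circ> i \<and>
    tensor_map id i \<circ> comult = tensor_map \<pi> id \<circ> comult \<circ> i"


section \<open>First-order differential calculi\<close>

text \<open>The carrier of the bimodule of one-forms is the whole type \<open>'w\<close>.\<close>

record ('a, 'w) calculus =
  lact :: "'a \<Rightarrow> 'w \<Rightarrow> 'w"
  ract :: "'w \<Rightarrow> 'a \<Rightarrow> 'w"
  diff :: "'a \<Rightarrow> 'w"

definition fodc :: "('a::complex_algebra_1, 'w::complex_vector) calculus \<Rightarrow> bool"
  where "fodc \<Omega> \<longleftrightarrow>
    cbilinear (lact \<Omega>) \<and> cbilinear (ract \<Omega>) \<and> clinear (diff \<Omega>) \<and>
    (\<forall>w. lact \<Omega> 1 w = w) \<and> (\<forall>a b w. lact \<Omega> (a * b) w = lact \<Omega> a (lact \<Omega> b w)) \<and>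
    (\<forall>w. ract \<Omega> w 1 = w) \<and> (\<forall>a b w. ract \<Omega> w (a * b) = ract \<Omega> (ract \<Omega> w a) b) \<and>
    (\<forall>a b w. ract \<Omega> (lact \<Omega> a w) b = lact \<Omega> a (ract \<Omega> w b)) \<and>
    (\<forall>a b. diff \<Omega> (a * b) = ract \<Omega> (diff \<Omega> a) b + lact \<Omega> a (diff \<Omega> b)) \<and>
    cspan {lact \<Omega> a (diff \<Omega> b) | a b. True} = UNIV"

definition left_covariant ::
    "('a::hopf_algebra, 'w::complex_vector) calculus \<Rightarrow> ('w \<Rightarrow> 'a \<otimes> 'w) \<Rightarrow> bool"
  where "left_covariant \<Omega> \<delta> \<longleftrightarrow> left_coaction \<delta> \<and>
    (\<forall>b c. \<delta> (lact \<Omega> b (diff \<Omega> c)) = tensor_sum (comult b) (\<lambda>b1 b2.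
       tensor_sum (comult c) (\<lambda>c1 c2. (b1 * c1) \<otimes> lact \<Omega> b2 (diff \<Omega> c2))))"

definition right_covariant ::
    "('a::hopf_algebra \<Rightarrow> 'h::hopf_algebra) \<Rightarrow> ('a, 'w::complex_vector) calculus
      \<Rightarrow> ('w \<Rightarrow> 'w \<otimes> 'h) \<Rightarrow> bool"
  where "right_covariant \<pi> \<Omega> \<rho> \<longleftrightarrow> right_coaction \<rho> \<and>
    (\<forall>b c. \<rho> (lact \<Omega> b (diff \<Omega> c)) = tensor_sum (coact_R \<pi> b) (\<lambda>b0 b1.
       tensor_sum (coact_R \<pi> c) (\<lambda>c0 c1. lact \<Omega> b0 (diff \<Omega> c0) \<otimes> (b1 * c1))))"

definition universal_forms :: "('a::complex_algebra_1 \<otimes> 'a) set"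
  where "universal_forms = {t. tensor_sum t (*) = 0}"

text \<open>The sub-bimodule \<open>N\<close> with \<open>\<Omega>\<^sup>1 = \<Omega>\<^sup>1\<^sub>u / N\<close>. Since \<open>a d\<^sub>u b = a \<otimes> b - ab \<otimes> 1\<close>, the canonical
  map from universal forms to \<open>\<Omega>\<^sup>1\<close> sends \<open>(\<Sum>k. a\<^sub>k \<otimes> b\<^sub>k)\<close> to \<open>(\<Sum>k. a\<^sub>k d b\<^sub>k)\<close>.\<close>

definition calculus_kernel ::
    "('a::complex_algebra_1, 'w::complex_vector) calculus \<Rightarrow> ('a \<otimes> 'a) set"
  where "calculus_kernel \<Omega> =
    {t \<in> universal_forms. tensor_sum t (\<lambda>a b. lact \<Omega> a (diff \<Omega> b)) = 0}"

definition ver :: "('a::hopf_algebra \<Rightarrow> 'h::hopf_algebra) \<Rightarrow> 'a \<otimes> 'a \<Rightarrow> 'a \<otimes> 'h"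
  where "ver \<pi> t = tensor_sum t (\<lambda>a' a. tensor_sum (comult a) (\<lambda>a1 a2. (a' * a1) \<otimes> \<pi> (aug a2)))"

definition canonical_map :: "('a::hopf_algebra \<Rightarrow> 'h::hopf_algebra) \<Rightarrow> 'a \<otimes> 'a \<Rightarrow> 'a \<otimes> 'h"
  where "canonical_map \<pi> t =
    tensor_sum t (\<lambda>a' a. tensor_sum (comult a) (\<lambda>a1 a2. (a' * a1) \<otimes> \<pi> a2))"

text \<open>Bijectivity of the map that \<open>canonical_map \<pi>\<close> induces on the cosets forming \<open>A \<otimes>\<^sub>B A\<close>.\<close>

definition hopf_galois :: "('a::hopf_algebra \<Rightarrow> 'h::hopf_algebra) \<Rightarrow> bool"
  where "hopf_galois \<pi> \<longleftrightarrow>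
    bij_betw (\<lambda>X. the_elem (canonical_map \<pi> ` X))
      (UNIV // {(s, t). s - t \<in> balanced (coinvariants \<pi>) UNIV (*)}) UNIV"

definition quantum_principal_bundle ::
    "('a::hopf_algebra \<Rightarrow> 'h::hopf_algebra) \<Rightarrow> ('a, 'w::complex_vector) calculus
      \<Rightarrow> ('w \<Rightarrow> 'a \<otimes> 'w) \<Rightarrow> ('w \<Rightarrow> 'w \<otimes> 'h) \<Rightarrow> bool"
  where "quantum_principal_bundle \<pi> \<Omega> \<delta> \<rho> \<longleftrightarrow>
    hopf_galois \<pi> \<and> fodc \<Omega> \<and> left_covariant \<Omega> \<delta> \<and> right_covariant \<pi> \<Omega> \<rho> \<and>
    (\<exists>I. right_ideal I \<and> I \<subseteq> aug_part UNIV \<and>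
       adjoint_coaction ` I \<subseteq> tensor_subspace I UNIV \<and>
       ver \<pi> ` calculus_kernel \<Omega> = tensor_subspace UNIV I)"

definition restricted_forms ::
    "('a::complex_algebra_1, 'w::complex_vector) calculus \<Rightarrow> 'a set \<Rightarrow> 'w set"
  where "restricted_forms \<Omega> B = cspan {lact \<Omega> a (diff \<Omega> b) | a b. a \<in> B \<and> b \<in> B}"


section \<open>Relative Hopf modules and their fibres\<close>

definition left_prod ::
    "('a, 'w::complex_vector) calculus \<Rightarrow> 'a set \<Rightarrow> 'w set \<Rightarrow> 'w set"
  where "left_prod \<Omega> X F = cspan {lact \<Omega> x f | x f. x \<in> X \<and> f \<in> F}"

definition right_prod ::
    "('a, 'w::complex_vector) calculus \<Rightarrow> 'w set \<Rightarrow> 'a set \<Rightarrow> 'w set"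
  where "right_prod \<Omega> F X = cspan {ract \<Omega> f x | f x. f \<in> F \<and> x \<in> X}"

text \<open>A subspace \<open>F\<close> of the forms is an object of the category \<open>\<^sup>A\<^sub>BMod\<^sub>B\<close>, respectively
  \<open>\<^sup>A\<^sub>BMod\<^sub>0\<close>, for the restricted \<open>B\<close>-actions and the restricted left coaction.\<close>

definition in_ABMod_B ::
    "('a::hopf_algebra, 'w::complex_vector) calculus \<Rightarrow> ('w \<Rightarrow> 'a \<otimes> 'w) \<Rightarrow> 'a set \<Rightarrow> 'w set \<Rightarrow> bool"
  where "in_ABMod_B \<Omega> \<delta> B F \<longleftrightarrow> csubspace F \<and>
    (\<forall>b\<in>B. \<forall>f\<in>F. lact \<Omega> b f \<in> F \<and> ract \<Omega> f b \<in> F) \<and>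
    \<delta> ` F \<subseteq> tensor_subspace UNIV F \<and>
    (\<forall>b\<in>B. \<forall>f\<in>F. \<forall>c\<in>B. \<delta> (ract \<Omega> (lact \<Omega> b f) c) =
       tensor_sum (comult b) (\<lambda>b1 b2. tensor_sum (\<delta> f) (\<lambda>a w. tensor_sum (comult c) (\<lambda>c1 c2.
         (b1 * a * c1) \<otimes> ract \<Omega> (lact \<Omega> b2 w) c2))))"

definition in_ABMod_0 ::
    "('a::hopf_algebra, 'w::complex_vector) calculus \<Rightarrow> ('w \<Rightarrow> 'a \<otimes> 'w) \<Rightarrow> 'a set \<Rightarrow> 'w set \<Rightarrow> bool"
  where "in_ABMod_0 \<Omega> \<delta> B F \<longleftrightarrow> in_ABMod_B \<Omega> \<delta> B F \<and>
    left_prod \<Omega> (aug_part B) F = right_prod \<Omega> F (aug_part B)"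

text \<open>\<open>q\<close> exhibits the type \<open>'q\<close> as the quotient vector space \<open>S / W\<close>. Quotients are presented in
  this way, rather than as sets of cosets, so that they are types and can be factors of \<open>\<otimes>\<close>.
  Values of \<open>q\<close> outside \<open>S\<close> are irrelevant.\<close>

definition quotient_map ::
    "'w::complex_vector set \<Rightarrow> 'w set \<Rightarrow> ('w \<Rightarrow> 'q::complex_vector) \<Rightarrow> bool"
  where "quotient_map S W q \<longleftrightarrow> csubspace S \<and>
    (\<forall>x\<in>S. \<forall>y\<in>S. q (x + y) = q x + q y) \<and> (\<forall>c. \<forall>x\<in>S. q (c *\<^sub>C x) = c *\<^sub>C q x) \<and>
    q ` S = UNIV \<and> {x \<in> S. q x = 0} = W"

definition is_Phi ::
    "('a::hopf_algebra, 'w::complex_vector) calculus \<Rightarrow> 'a set \<Rightarrow> 'w set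
      \<Rightarrow> ('w \<Rightarrow> 'v::complex_vector) \<Rightarrow> bool"
  where "is_Phi \<Omega> B F q \<longleftrightarrow> quotient_map F (left_prod \<Omega> (aug_part B) F) q"

definition is_F ::
    "('a::hopf_algebra, 'w::complex_vector) calculus \<Rightarrow> ('w \<Rightarrow> 'f::complex_vector) \<Rightarrow> bool"
  where "is_F \<Omega> q \<longleftrightarrow> quotient_map UNIV (left_prod \<Omega> (aug_part UNIV) UNIV) q"

definition F_act ::
    "('a::hopf_algebra, 'w::complex_vector) calculus \<Rightarrow> ('w \<Rightarrow> 'f::complex_vector)
      \<Rightarrow> 'f \<Rightarrow> 'a \<Rightarrow> 'f"
  where "F_act \<Omega> q x a = q (ract \<Omega> (inv q x) a)"

text \<open>Under the identification \<open>[a db] \<mapsto> \<epsilon>(a) b\<^sup>+\<close> of \<open>F(\<Omega>\<^sup>1(A))\<close> with \<open>A\<^sup>+ / I\<^sub>A\<close>, and of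
  \<open>\<Phi>(\<Omega>\<^sup>1(B))\<close> with \<open>B\<^sup>+ / I\<^sub>B\<close>, the class \<open>[a]\<close> of \<open>a \<in> A\<^sup>+\<close> is the class of \<open>da\<close>, and for a
  general \<open>a\<close> the class of \<open>da\<close> is \<open>[a\<^sup>+]\<close>.\<close>

definition cls ::
    "('a, 'w) calculus \<Rightarrow> ('w \<Rightarrow> 'q) \<Rightarrow> 'a \<Rightarrow> 'q"
  where "cls \<Omega> q a = q (diff \<Omega> a)"

text \<open>The map \<open>\<Phi>(\<Omega>\<^sup>1(B)) \<rightarrow> F(\<Omega>\<^sup>1(A))\<close> induced by the inclusion of forms; it is the inclusion
  \<open>B\<^sup>+ / I\<^sub>B \<rightarrow> A\<^sup>+ / I\<^sub>A\<close>.\<close>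

definition iota ::
    "('a::hopf_algebra, 'w::complex_vector) calculus \<Rightarrow> 'a set \<Rightarrow> ('w \<Rightarrow> 'v::complex_vector)
      \<Rightarrow> ('w \<Rightarrow> 'f::complex_vector) \<Rightarrow> 'v \<Rightarrow> 'f"
  where "iota \<Omega> B qPhi qF v = qF (inv_into (restricted_forms \<Omega> B) qPhi v)"

text \<open>The action \<open>[b] \<triangleleft> h = [b] \<triangleleft>\<^sub>A i(h)\<close>, where \<open>\<Phi>(\<Omega>\<^sup>1(B))\<close> is identified with its image
  under \<open>\<iota>\<close>.\<close>

definition splitting_action ::
    "('a::hopf_algebra, 'w::complex_vector) calculus \<Rightarrow> 'a set \<Rightarrow> ('w \<Rightarrow> 'v::complex_vector)
      \<Rightarrow> ('w \<Rightarrow> 'f::complex_vector) \<Rightarrow> ('h::hopf_algebra \<Rightarrow> 'a) \<Rightarrow> 'v \<Rightarrow> 'h \<Rightarrow> 'v"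
  where "splitting_action \<Omega> B qPhi qF i v h =
    (THE v'. iota \<Omega> B qPhi qF v' = F_act \<Omega> qF (iota \<Omega> B qPhi qF v) (i h))"

text \<open>\<open>ad\<close> is the map \<open>Ad\<^sub>\<pi>\<close>. The Sweedler factors \<open>b\<^sub>(\<^sub>2\<^sub>)\<close> have to be taken in \<open>B\<close>, where \<open>[_]\<close>
  is defined; this is possible because \<open>\<Delta>(B) \<subseteq> A \<otimes> B\<close>.\<close>

definition is_Ad_pi ::
    "('a::hopf_algebra \<Rightarrow> 'h::hopf_algebra) \<Rightarrow> ('a, 'w::complex_vector) calculus
      \<Rightarrow> ('w \<Rightarrow> 'v::complex_vector) \<Rightarrow> ('v \<Rightarrow> 'v \<otimes> 'h) \<Rightarrow> bool"
  where "is_Ad_pi \<pi> \<Omega> qPhi ad \<longleftrightarrow> clinear ad \<and>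
    (\<forall>b\<in>aug_part (coinvariants \<pi>). \<forall>ps. snd ` set ps \<subseteq> coinvariants \<pi> \<and>
       comult b = (\<Sum>(b1, b2)\<leftarrow>ps. b1 \<otimes> b2) \<longrightarrow>
       ad (cls \<Omega> qPhi b) = (\<Sum>(b1, b2)\<leftarrow>ps. cls \<Omega> qPhi b2 \<otimes> \<pi> (antipode b1)))"

end

theory Submission
  imports Defs
begin

text \<open>Let \<open>\<theta>(w) = S(w\<^sub>(\<^sub>-\<^sub>1\<^sub>)) w\<^sub>(\<^sub>0\<^sub>)\<close> be the projection onto the left-coinvariant forms. It kills \<open>A\<^sup>+\<Omega>\<^sup>1(A)\<close>,
  every form is \<open>w = w\<^sub>(\<^sub>-\<^sub>1\<^sub>) \<theta>(w\<^sub>(\<^sub>0\<^sub>))\<close>, and right covariance gives a coaction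
  \<open>[a] \<mapsto> [a\<^sub>(\<^sub>2\<^sub>)] \<otimes> \<pi>(S(a\<^sub>(\<^sub>1\<^sub>)) a\<^sub>(\<^sub>3\<^sub>))\<close> on \<open>F(\<Omega>\<^sup>1(A))\<close>, which restricts to \<open>Ad\<^sub>\<pi>\<close>.
  The map \<open>\<iota>\<close> is injective: if \<open>[b] = 0\<close> in \<open>F(\<Omega>\<^sup>1(A))\<close> for \<open>b \<in> B\<^sup>+\<close>, applying the coaction and cancelling
  the antipode of \<open>H\<close> gives \<open>\<pi>(b\<^sub>(\<^sub>1\<^sub>)) \<otimes> [b\<^sub>(\<^sub>2\<^sub>)] = 0\<close>, hence \<open>db \<in> ker(\<pi>) \<Omega>\<^sup>1(A) = B\<^sup>+\<Omega>\<^sup>1(A)\<close>, where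
  \<open>ker(\<pi>) = B\<^sup>+A\<close> is a consequence of the Hopf-Galois property; flatness then yields \<open>db \<in> B\<^sup>+\<Omega>\<^sup>1(B)\<close>.
  Since \<open>\<Omega>\<^sup>1(B)B\<^sup>+ = B\<^sup>+\<Omega>\<^sup>1(B)\<close>, the right ideal \<open>B\<^sup>+A = ker(\<pi>)\<close> annihilates the image of \<open>\<iota>\<close>, so the
  \<open>A\<close>-action on it factors through \<open>H\<close>. Hence \<open>\<triangleleft>\<close> is an action that does not depend on \<open>i\<close>, and the
  Yetter-Drinfeld condition can be checked in \<open>F(\<Omega>\<^sup>1(A)) \<otimes> H\<close>.\<close>

section \<open>Multilinear maps and tensors\<close>

interpretation complex_vector_pair:
    vector_space_pair "scaleC :: complex \<Rightarrow> 'a::complex_vector \<Rightarrow> 'a" "scaleC :: complex \<Rightarrow> 'b::complex_vector \<Rightarrow> 'b"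
  by unfold_locales

text \<open>Since \<open>tensor_sum\<close> respects the tensor relations only for bilinear
  arguments, nearly every rewrite below carries linearity side conditions; these rules split them
  along the shape of the term.\<close>

named_theorems lin

lemma cbilinearI [lin]:
  assumes "\<And>x. clinear (\<lambda>y. f x y)" and "\<And>y. clinear (\<lambda>x. f x y)"
  shows "cbilinear f"
  using assms by (simp add: cbilinear_def)

lemma cbilinearD:
  assumes "cbilinear f"
  shows "clinear (f x)" and "clinear (\<lambda>x. f x y)"
  using assms by (auto simp: cbilinear_def)

lemma clinear_iff: "clinear f \<longleftrightarrow> (\<forall>x y. f (x + y) = f x + f y) \<and> (\<forall>c x. f (c *\<^sub>C x) = c *\<^sub>C f x)"
  by (auto simp: clinear_add clinear_scale intro: clinearI)

lemma clinear_compose: "clinear g \<Longrightarrow> clinear f \<Longrightarrow> clinear (\<lambda>x. g (f x))"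
  by (simp add: clinear_iff)

lemmas clinear_zero = complex_vector_pair.linear_0
  and clinear_diff = complex_vector_pair.linear_diff
  and clinear_sum = complex_vector_pair.linear_sum

lemma clinear_sum_list: "clinear f \<Longrightarrow> f (sum_list xs) = (\<Sum>x\<leftarrow>xs. f x)"
  by (induction xs) (simp_all add: clinear_zero clinear_add)

lemma clinear_ident [lin]: "clinear (\<lambda>x. x)" "clinear id"
  by (simp_all add: clinear_iff id_def)

lemma clinear_scaleC [lin]:
  "clinear f \<Longrightarrow> clinear (\<lambda>x. c *\<^sub>C f x)"
  "clinear g \<Longrightarrow> clinear (\<lambda>x. g x *\<^sub>C y)"
proof -
  show "clinear f \<Longrightarrow> clinear (\<lambda>x. c *\<^sub>C f x)"
    by (auto simp: clinear_iff scaleC_add_right scaleC_scaleC mult.commute)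
  assume g: "clinear g"
  show "clinear (\<lambda>x. g x *\<^sub>C y)"
    by (rule clinearI) (simp_all only: clinear_add[OF g] clinear_scale[OF g] scaleC_add_left
        scaleC_scaleC scaleC_complex_def)
qed

lemma clinear_plus_minus [lin]:
  assumes "clinear f" "clinear g"
  shows "clinear (\<lambda>x. f x + g x)" "clinear (\<lambda>x. f x - g x)"
  using assms by (auto simp: clinear_iff scaleC_add_right
      complex_vector.scale_right_diff_distrib algebra_simps)

lemma clinear_times [lin]:
  fixes c :: "'a::complex_algebra_1"
  assumes "clinear f"
  shows "clinear (\<lambda>x. f x * c)" "clinear (\<lambda>x. c * f x)"
  using assms by (auto simp: clinear_iff algebra_simps mult_scaleC_left mult_scaleC_right)

section \<open>Pure tensors and the universal property\<close>

lemma tensor_of_bilinear: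
  "(x + x') \<otimes> y = x \<otimes> y + x' \<otimes> y" "x \<otimes> (y + y') = x \<otimes> y + x \<otimes> y'"
  "(c *\<^sub>C x) \<otimes> y = c *\<^sub>C (x \<otimes> y)" "x \<otimes> (c *\<^sub>C y) = c *\<^sub>C (x \<otimes> y)"
proof -
  have *: "p - q \<in> tensor_relations \<Longrightarrow> tensor_rel p q" for p q :: "('a \<times> 'b) \<Rightarrow>\<^sub>0 complex"
    by (simp add: tensor_rel_def complex_vector.span_base)
  show "(x + x') \<otimes> y = x \<otimes> y + x' \<otimes> y" "x \<otimes> (y + y') = x \<otimes> y + x \<otimes> y'"
    "(c *\<^sub>C x) \<otimes> y = c *\<^sub>C (x \<otimes> y)" "x \<otimes> (c *\<^sub>C y) = c *\<^sub>C (x \<otimes> y)"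
    by (transfer, rule *, unfold tensor_relations_def diff_diff_eq[symmetric], blast)+
qed

lemma clinear_tensor_of [lin]:
  assumes "clinear f"
  shows "clinear (\<lambda>x. f x \<otimes> y)" "clinear (\<lambda>x. y \<otimes> f x)"
  using assms by (auto simp: clinear_iff tensor_of_bilinear)

text \<open>The sum is taken over the fixed representative \<open>rep_tensor t\<close>, so it is a
  finite linear combination of values of \<open>f x\<close>.\<close>

lemma clinear_tensor_sum_fun [lin]:
  assumes "\<And>u v. clinear (\<lambda>x. f x u v)"
  shows "clinear (\<lambda>x. tensor_sum t (f x))"
proof -
  have "f (x + y) u v = f x u v + f y u v" "f (c *\<^sub>C x) u v = c *\<^sub>C f x u v" for x y u v c
    using assms[of u v] by (auto simp: clinear_iff)
  then show ?thesis
    by (intro clinearI)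
      (simp_all add: tensor_sum_def free_sum_def scaleC_add_right sum.distrib scaleC_scaleC
        complex_vector.scale_sum_right mult.commute)
qed

lemma clinear_tensor_sum_arg [lin]:
  assumes "clinear g" "cbilinear f"
  shows "clinear (\<lambda>x. tensor_sum (g x) f)"
  using clinear_compose[OF clinear_tensor_sum[OF assms(2)] assms(1)] .

lemma tensor_sum_linear:
  assumes "clinear L"
  shows "L (tensor_sum t f) = tensor_sum t (\<lambda>x y. L (f x y))"
  by (simp add: tensor_sum_def free_sum_def clinear_sum[OF assms] clinear_scale[OF assms])

text \<open>Both sides are the same finite double sum over the chosen representatives of
  \<open>s\<close> and \<open>t\<close>.\<close>

lemma tensor_sum_swap:
  "tensor_sum s (\<lambda>a b. tensor_sum t (\<lambda>c e. f a b c e)) = tensor_sum t (\<lambda>c e. tensor_sum s (\<lambda>a b. f a b c e))"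
  unfolding tensor_sum_def free_sum_def complex_vector.scale_sum_right
  by (subst sum.swap) (simp add: scaleC_scaleC mult.commute)

lemma free_sum_single_eq: "free_sum p (\<lambda>x y. Poly_Mapping.single (x, y) 1) = p"
proof (rule poly_mapping_eqI)
  fix k
  have "Poly_Mapping.lookup (free_sum p (\<lambda>x y. Poly_Mapping.single (x, y) 1)) k =
      (\<Sum>j\<in>Poly_Mapping.keys p. Poly_Mapping.lookup p j * (1 when j = k))"
    by (simp add: free_sum_def lookup_sum lookup_scaleC scaleC_complex_def lookup_single)
  also have "\<dots> = Poly_Mapping.lookup p k"
    by (simp add: sum.delta in_keys_iff when_def mult.commute if_distrib cong: if_cong)
  finally show "Poly_Mapping.lookup (free_sum p (\<lambda>x y. Poly_Mapping.single (x, y) 1)) k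
    = Poly_Mapping.lookup p k" .
qed

lemma clinear_abs_tensor: "clinear abs_tensor"
  by (rule clinearI) (simp_all add: plus_tensor.abs_eq scaleC_tensor.abs_eq)

text \<open>The expansion of a finitely supported function into singletons, pushed through the
  quotient. It makes a linear map on a tensor product determined by its values on pure
  tensors.\<close>

lemma tensor_sum_tensor_of_self: "tensor_sum t (\<otimes>) = t"
proof -
  obtain p where p: "t = abs_tensor p"
    by (metis Quotient3_abs_rep[OF Quotient3_tensor])
  have "tensor_sum t (\<otimes>) = free_sum p (\<otimes>)"
    unfolding p by (rule tensor_sum_abs) (intro lin)
  also have "\<dots> = abs_tensor (free_sum p (\<lambda>x y. Poly_Mapping.single (x, y) 1))"
    by (simp add: free_sum_def clinear_sum[OF clinear_abs_tensor] clinear_scale[OF clinear_abs_tensor]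
        tensor_of.abs_eq)
  finally show ?thesis
    by (simp add: free_sum_single_eq p)
qed

lemma tensor_linear_eq:
  assumes "clinear L"
  shows "L t = tensor_sum t (\<lambda>x y. L (x \<otimes> y))"
  using tensor_sum_linear[OF assms, of t "(\<otimes>)"] by (simp add: tensor_sum_tensor_of_self)

lemma tensor_eqI:
  assumes "clinear L" "clinear M" "\<And>x y. L (x \<otimes> y) = M (x \<otimes> y)"
  shows "L t = M t"
  using tensor_linear_eq[OF assms(1), of t] tensor_linear_eq[OF assms(2), of t] assms(3) by simp

lemma tensor_sum_tensor_sum:
  assumes "cbilinear f"
  shows "tensor_sum (tensor_sum t g) f = tensor_sum t (\<lambda>x y. tensor_sum (g x y) f)"
  by (rule tensor_sum_linear[OF clinear_tensor_sum[OF assms]])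

lemma tensor_sum_diff: "tensor_sum t (\<lambda>x y. f x y - g x y) = tensor_sum t f - tensor_sum t g"
  by (simp add: tensor_sum_def free_sum_def complex_vector.scale_right_diff_distrib sum_subtractf)

lemma tensor_sum_zero: "tensor_sum t (\<lambda>x y. 0) = 0"
  by (simp add: tensor_sum_def free_sum_def)

section \<open>Tensor products of linear maps\<close>

lemma tensor_map_tensor_of:
  assumes "clinear f" "clinear g"
  shows "tensor_map f g (x \<otimes> y) = f x \<otimes> g y"
  unfolding tensor_map_def by (rule tensor_sum_tensor_of) (intro lin assms)

lemma tensor_assoc_tensor_of: "tensor_assoc ((x \<otimes> y) \<otimes> z) = x \<otimes> y \<otimes> z"
  unfolding tensor_assoc_def by (subst tensor_sum_tensor_of, (intro lin)[1])+ simp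

lemma clinear_tensor_map [lin]:
  assumes "clinear f" "clinear g" "clinear h"
  shows "clinear (\<lambda>x. tensor_map f g (h x))"
  unfolding tensor_map_def by (intro lin assms clinear_compose[OF assms(1)] clinear_compose[OF assms(2)])

lemma clinear_tensor_assoc [lin]:
  assumes "clinear h"
  shows "clinear (\<lambda>x. tensor_assoc (h x))"
  unfolding tensor_assoc_def by (intro lin assms)

lemma tensor_sum_tensor_map:
  assumes "clinear f" "clinear g" "cbilinear k"
  shows "tensor_sum (tensor_map f g t) k = tensor_sum t (\<lambda>x y. k (f x) (g y))"
  unfolding tensor_map_def
  by (simp add: tensor_sum_tensor_sum[OF assms(3)] tensor_sum_tensor_of[OF assms(3)])

lemma tensor_map_tensor_map:
  assumes "clinear f" "clinear g" "clinear f'" "clinear g'"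
  shows "tensor_map f' g' (tensor_map f g t) = tensor_map (\<lambda>x. f' (f x)) (\<lambda>x. g' (g x)) t"
  unfolding tensor_map_def[of f' g']
  by (subst tensor_sum_tensor_map) (intro lin assms | simp add: tensor_map_def)+

lemma tensor_map_ident: "tensor_map (\<lambda>x. x) (\<lambda>x. x) t = t"
  by (simp add: tensor_map_def tensor_sum_tensor_of_self)

lemma tensor_map_id: "tensor_map id id = id"
  by (simp add: fun_eq_iff id_def tensor_map_ident)

lemma tensor_assoc_natural:
  assumes "clinear f" "clinear g" "clinear h"
  shows "tensor_assoc (tensor_map (tensor_map f g) h t) = tensor_map f (tensor_map g h) (tensor_assoc t)"
proof (rule tensor_eqI[where L = "\<lambda>t. tensor_assoc (tensor_map (tensor_map f g) h t)"
      and M = "\<lambda>t. tensor_map f (tensor_map g h) (tensor_assoc t)" and t = t])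
  show "clinear (\<lambda>t. tensor_assoc (tensor_map (tensor_map f g) h t))"
    "clinear (\<lambda>t. tensor_map f (tensor_map g h) (tensor_assoc t))"
    by (intro lin assms clinear_tensor_map[where h = "\<lambda>x. x", OF assms(1,2), simplified]
        clinear_tensor_map[where h = "\<lambda>x. x", OF assms(2,3), simplified])+
  fix s z
  have fg: "clinear (tensor_map f g)" "clinear (tensor_map g h)"
    using clinear_tensor_map[OF assms(1,2) clinear_ident(1)] clinear_tensor_map[OF assms(2,3) clinear_ident(1)] by auto
  show "tensor_assoc (tensor_map (tensor_map f g) h (s \<otimes> z)) = tensor_map f (tensor_map g h) (tensor_assoc (s \<otimes> z))"
    by (rule tensor_eqI[where L = "\<lambda>s. tensor_assoc (tensor_map (tensor_map f g) h (s \<otimes> z))"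
        and M = "\<lambda>s. tensor_map f (tensor_map g h) (tensor_assoc (s \<otimes> z))" and t = s])
      (intro lin assms fg | simp add: tensor_map_tensor_of tensor_assoc_tensor_of assms fg)+
qed

lemma csubspace_tensor_subspace: "csubspace (tensor_subspace X Y)"
  unfolding tensor_subspace_def by (rule complex_vector.subspace_span)

lemma tensor_sum_in_subspace:
  assumes "csubspace S" "\<And>x y. f x y \<in> S"
  shows "tensor_sum t f \<in> S"
  unfolding tensor_sum_def free_sum_def
  using assms
  by (intro complex_vector.subspace_sum complex_vector.subspace_scale) auto

lemma tensor_of_in_subspace: "x \<in> X \<Longrightarrow> y \<in> Y \<Longrightarrow> x \<otimes> y \<in> tensor_subspace X Y"
  unfolding tensor_subspace_def by (rule complex_vector.span_base) blast

section \<open>Kernels of tensored maps and explicit decompositions\<close>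

lemma linear_generalized_inverse:
  assumes "clinear f"
  obtains g where "clinear g" "\<And>x. f (g (f x)) = f x"
  using complex_vector_pair.linear_exists_right_inverse_on[OF assms, of UNIV] by auto

text \<open>A generalized inverse \<open>g\<close> of \<open>\<phi>\<close> makes \<open>id - g \<phi>\<close> a projection onto the kernel.\<close>

lemma tensor_map_id_kernel:
  assumes \<phi>: "clinear \<phi>" and t: "tensor_map id \<phi> t = 0"
  shows "t \<in> tensor_subspace UNIV {y. \<phi> y = 0}"
proof -
  obtain g where g: "clinear g" "\<And>x. \<phi> (g (\<phi> x)) = \<phi> x"
    using linear_generalized_inverse[OF \<phi>] by metis
  have "tensor_map id g (tensor_map id \<phi> t) = 0"
    unfolding t by (rule clinear_zero) (intro lin g)
  then have "tensor_sum t (\<lambda>x y. x \<otimes> g (\<phi> y)) = 0"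
    by (subst (asm) tensor_map_tensor_map) (intro lin g \<phi> | simp add: tensor_map_def)+
  \<comment> \<open>The terms \<open>x \<otimes> g (\<phi> y)\<close> sum to zero, so the second
    factors may be projected onto the kernel without changing \<open>t\<close>.\<close>
  then have "tensor_sum t (\<lambda>x y. x \<otimes> (y - g (\<phi> y))) = t"
    by (simp add: clinear_diff[OF clinear_tensor_of(2)[OF clinear_ident(1)]] tensor_sum_diff
        tensor_sum_tensor_of_self)
  moreover have "tensor_sum t (\<lambda>x y. x \<otimes> (y - g (\<phi> y))) \<in> tensor_subspace UNIV {y. \<phi> y = 0}"
    by (intro tensor_sum_in_subspace csubspace_tensor_subspace tensor_of_in_subspace)
      (simp_all add: clinear_diff[OF \<phi>] g)
  ultimately show ?thesis by simp
qed

text \<open>The mirror image of \<open>tensor_map_id_kernel\<close>, with the projection in the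
  first factor.\<close>

lemma tensor_map_kernel_id:
  assumes \<phi>: "clinear \<phi>" and t: "tensor_map \<phi> id t = 0"
  shows "t \<in> tensor_subspace {y. \<phi> y = 0} UNIV"
proof -
  obtain g where g: "clinear g" "\<And>x. \<phi> (g (\<phi> x)) = \<phi> x"
    using linear_generalized_inverse[OF \<phi>] by metis
  have "tensor_map g id (tensor_map \<phi> id t) = 0"
    unfolding t by (rule clinear_zero) (intro lin g)
  then have "tensor_sum t (\<lambda>x y. g (\<phi> x) \<otimes> y) = 0"
    by (subst (asm) tensor_map_tensor_map) (intro lin g \<phi> | simp add: tensor_map_def)+
  then have "tensor_sum t (\<lambda>x y. (x - g (\<phi> x)) \<otimes> y) = t"
    by (simp add: clinear_diff[OF clinear_tensor_of(1)[OF clinear_ident(1)]] tensor_sum_diff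
        tensor_sum_tensor_of_self)
  moreover have "tensor_sum t (\<lambda>x y. (x - g (\<phi> x)) \<otimes> y) \<in> tensor_subspace {y. \<phi> y = 0} UNIV"
    by (intro tensor_sum_in_subspace csubspace_tensor_subspace tensor_of_in_subspace)
      (simp_all add: clinear_diff[OF \<phi>] g)
  ultimately show ?thesis by simp
qed

text \<open>Supplies the lists of pairs over which \<open>is_Ad_pi\<close> quantifies; scalars are
  absorbed into the first factor.\<close>

lemma tensor_subspace_UNIV_sum_list:
  assumes "t \<in> tensor_subspace UNIV Y" "csubspace Y"
  obtains ps where "snd ` set ps \<subseteq> Y" "t = (\<Sum>(x, y)\<leftarrow>ps. x \<otimes> y)"
proof -
  have "\<exists>ps. snd ` set ps \<subseteq> Y \<and> t = (\<Sum>(x, y)\<leftarrow>ps. x \<otimes> y)"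
    using assms(1) unfolding tensor_subspace_def
  proof (induction rule: complex_vector.span_induct_alt)
    case base
    show ?case by (intro exI[of _ "[]"]) simp
  next
    case (step c t s)
    then obtain x y ps where "t = x \<otimes> y" "y \<in> Y" "snd ` set ps \<subseteq> Y" "s = (\<Sum>(x, y)\<leftarrow>ps. x \<otimes> y)"
      by auto
    then show ?case
      by (intro exI[of _ "(c *\<^sub>C x, y) # ps"]) (simp add: tensor_of_bilinear)
  qed
  then show ?thesis using that by blast
qed

lemma tensor_sum_sum_list:
  assumes "cbilinear f"
  shows "tensor_sum (\<Sum>(x, y)\<leftarrow>ps. x \<otimes> y) f = (\<Sum>(x, y)\<leftarrow>ps. f x y)"
proof (induction ps)
  case Nil
  then show ?case by (simp add: clinear_zero[OF clinear_tensor_sum[OF assms]])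
next
  case (Cons p ps)
  then show ?case
    by (cases p) (simp add: clinear_add[OF clinear_tensor_sum[OF assms]] tensor_sum_tensor_of[OF assms])
qed

section \<open>Hopf algebras\<close>

abbreviation sw :: "'a::hopf_algebra \<Rightarrow> ('a \<Rightarrow> 'a \<Rightarrow> 'c::complex_vector) \<Rightarrow> 'c"
  where "sw a f \<equiv> tensor_sum (comult a) f"

lemma clinear_hopf [lin]:
  assumes "clinear f"
  shows "clinear (\<lambda>x. comult (f x))" "clinear (\<lambda>x. counit (f x))" "clinear (\<lambda>x. antipode (f x))"
  using assms clinear_compose[OF clinear_comult] clinear_compose[OF clinear_counit]
      clinear_compose[OF clinear_antipode] by blast+

text \<open>Apply the linear map \<open>?L\<close> induced by the trilinear \<open>f\<close> to both
  sides of \<open>eq\<close>. Keeping \<open>g\<close> and \<open>h\<close> general covers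
  coassociativity of the comultiplication and of the left coaction on forms at once.\<close>

lemma assoc_eq_tensor_sum:
  assumes f: "\<And>y z. clinear (\<lambda>x. f x y z)" "\<And>x z. clinear (\<lambda>y. f x y z)" "\<And>x y. clinear (\<lambda>z. f x y z)"
    and g: "clinear g" and h: "clinear h"
    and eq: "tensor_assoc (tensor_map g id s) = tensor_map id h t"
  shows "tensor_sum s (\<lambda>x z. tensor_sum (g x) (\<lambda>x1 x2. f x1 x2 z)) =
    tensor_sum t (\<lambda>x y. tensor_sum (h y) (\<lambda>y1 y2. f x y1 y2))"
proof -
  let ?L = "\<lambda>u. tensor_sum u (\<lambda>x v. tensor_sum v (\<lambda>y z. f x y z))"
  have L: "clinear ?L" by (intro lin f)
  have "?L (tensor_assoc (x \<otimes> z)) = tensor_sum x (\<lambda>x1 x2. f x1 x2 z)" for x z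
  proof -
    have "?L (tensor_assoc (u \<otimes> z)) = tensor_sum u (\<lambda>x1 x2. ?L (tensor_assoc ((x1 \<otimes> x2) \<otimes> z)))" for u
      by (rule tensor_linear_eq) (intro lin f)
    then show ?thesis
      by (simp add: tensor_assoc_tensor_of tensor_sum_tensor_of cbilinearI lin f)
  qed
  then have "?L (tensor_assoc (tensor_map g id s)) = tensor_sum s (\<lambda>x z. tensor_sum (g x) (\<lambda>x1 x2. f x1 x2 z))"
    unfolding tensor_map_def
    by (subst tensor_sum_linear[where L = "\<lambda>u. ?L (tensor_assoc u)"]) (intro lin f | simp)+
  moreover have "?L (tensor_map id h t) = tensor_sum t (\<lambda>x y. tensor_sum (h y) (\<lambda>y1 y2. f x y1 y2))"
    unfolding tensor_map_def
    by (subst tensor_sum_linear[OF L]) (simp add: tensor_sum_tensor_of cbilinearI lin f)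
  ultimately show ?thesis by (simp add: eq)
qed

lemma sw_coassoc:
  assumes f: "\<And>y z. clinear (\<lambda>x. f x y z)" "\<And>x z. clinear (\<lambda>y. f x y z)" "\<And>x y. clinear (\<lambda>z. f x y z)"
  shows "sw a (\<lambda>x z. sw x (\<lambda>x1 x2. f x1 x2 z)) = sw a (\<lambda>x y. sw y (\<lambda>y1 y2. f x y1 y2))"
  by (rule assoc_eq_tensor_sum[OF f clinear_comult clinear_comult coassoc])

lemma sw_counit:
  assumes "clinear f"
  shows "sw a (\<lambda>x y. counit x *\<^sub>C f y) = f a" "sw a (\<lambda>x y. counit y *\<^sub>C f x) = f a"
  using tensor_sum_linear[OF assms, of "comult a" "\<lambda>x y. counit x *\<^sub>C y"]
    tensor_sum_linear[OF assms, of "comult a" "\<lambda>x y. counit y *\<^sub>C x"]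
  by (simp_all add: counit_left counit_right clinear_scale[OF assms])

lemma sw_antipode:
  assumes "clinear f"
  shows "sw a (\<lambda>x y. f (antipode x * y)) = counit a *\<^sub>C f 1"
    "sw a (\<lambda>x y. f (x * antipode y)) = counit a *\<^sub>C f 1"
  using tensor_sum_linear[OF assms, of "comult a" "\<lambda>x y. antipode x * y"]
    tensor_sum_linear[OF assms, of "comult a" "\<lambda>x y. x * antipode y"]
  by (simp_all add: antipode_left antipode_right clinear_scale[OF assms])

text \<open>Contraction of two neighbours among three Sweedler legs. In the first two parts the pair
  is on the left, which requires coassociativity; in the third it is on the right, where the nesting
  already fits.\<close>

lemma sw_antipode_cancel:
  assumes f: "\<And>y. clinear (\<lambda>x. f x y)" "\<And>x. clinear (\<lambda>y. f x y)"
  shows "sw a (\<lambda>x r. sw r (\<lambda>y z. f (antipode x * y) z)) = f 1 a"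
    and "sw a (\<lambda>x r. sw r (\<lambda>y z. f (x * antipode y) z)) = f 1 a"
    and "sw a (\<lambda>x r. sw r (\<lambda>y z. f (y * antipode z) x)) = f 1 a"
proof -
  note l = lin clinear_compose[OF f(1)] clinear_compose[OF f(2)]
  show "sw a (\<lambda>x r. sw r (\<lambda>y z. f (antipode x * y) z)) = f 1 a"
    "sw a (\<lambda>x r. sw r (\<lambda>y z. f (x * antipode y) z)) = f 1 a"
    by (subst sw_coassoc[where f = "\<lambda>x y z. f (antipode x * y) z", symmetric]
        sw_coassoc[where f = "\<lambda>x y z. f (x * antipode y) z", symmetric];
      (intro l)?; simp add: sw_antipode[OF f(1)] sw_counit[OF f(2)])+
  show "sw a (\<lambda>x r. sw r (\<lambda>y z. f (y * antipode z) x)) = f 1 a"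
    by (simp add: sw_antipode[OF f(1)] sw_counit[OF f(2)])
qed

lemma sw_mult:
  assumes "cbilinear f"
  shows "sw (a * b) f = sw a (\<lambda>a1 a2. sw b (\<lambda>b1 b2. f (a1 * b1) (a2 * b2)))"
  by (simp add: comult_mult tensor_sum_tensor_sum[OF assms] tensor_sum_tensor_of[OF assms])

lemma sw_one: "cbilinear f \<Longrightarrow> sw 1 f = f 1 1"
  by (simp add: comult_one tensor_sum_tensor_of)

text \<open>Apply the counit to \<open>S(a1) a2 = \<epsilon>(a) 1\<close>.\<close>

lemma counit_antipode: "counit (antipode a) = counit a"
proof -
  have "counit a = sw a (\<lambda>x y. counit (antipode x * y))"
    by (subst sw_antipode) (intro lin | simp add: counit_one scaleC_complex_def)+
  also have "\<dots> = sw a (\<lambda>x y. counit y *\<^sub>C counit (antipode x))"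
    by (simp add: counit_mult scaleC_complex_def mult.commute)
  also have "\<dots> = counit (antipode a)"
    by (rule sw_counit) (intro lin)
  finally show ?thesis by simp
qed

text \<open>Uniqueness of convolution inverses: \<open>S(a1 b1) a2 b2 S(b3) S(a3)\<close> is
  evaluated twice. Contracting the left part leaves \<open>S(b) S(a)\<close>; contracting first
  \<open>b2 S(b3)\<close> and then \<open>a2 S(a3)\<close> leaves \<open>S(ab)\<close>.\<close>

lemma antipode_mult: "antipode (a * b) = antipode b * antipode a"
proof -
  let ?E = "\<lambda>a1 a2 a3 b1 b2 b3. antipode (a1 * b1) * (a2 * b2) * (antipode b3 * antipode a3)"
  have "sw a (\<lambda>a1 ar. sw ar (\<lambda>a2 a3. sw b (\<lambda>b1 br. sw br (\<lambda>b2 b3. ?E a1 a2 a3 b1 b2 b3))))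
      = sw a (\<lambda>u a3. sw u (\<lambda>a1 a2. sw b (\<lambda>b1 br. sw br (\<lambda>b2 b3. ?E a1 a2 a3 b1 b2 b3))))"
    by (rule sw_coassoc[symmetric]; intro lin)
  also have "\<dots> = sw a (\<lambda>u a3. sw u (\<lambda>a1 a2. sw b (\<lambda>v b3. sw v (\<lambda>b1 b2. ?E a1 a2 a3 b1 b2 b3))))"
    by (subst sw_coassoc) (intro lin | rule refl)+
  also have "\<dots> = sw a (\<lambda>u a3. sw b (\<lambda>v b3. sw u (\<lambda>a1 a2. sw v (\<lambda>b1 b2. ?E a1 a2 a3 b1 b2 b3))))"
    by (subst tensor_sum_swap) simp
  also have "\<dots> = sw a (\<lambda>u a3. sw b (\<lambda>v b3. sw (u * v) (\<lambda>x y. antipode x * y * (antipode b3 * antipode a3))))"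
    by (subst sw_mult) (intro lin | rule refl)+
  also have "\<dots> = sw a (\<lambda>u a3. counit u *\<^sub>C sw b (\<lambda>v b3. counit v *\<^sub>C (antipode b3 * antipode a3)))"
    by (subst sw_antipode)
      (intro lin | simp add: counit_mult scaleC_scaleC tensor_sum_linear[OF clinear_scaleC(1)[OF clinear_ident(1)]])+
  also have "\<dots> = antipode b * antipode a"
    by (subst sw_counit, intro lin)+ simp
  finally have 1: "sw a (\<lambda>a1 ar. sw ar (\<lambda>a2 a3. sw b (\<lambda>b1 br. sw br (\<lambda>b2 b3. ?E a1 a2 a3 b1 b2 b3))))
    = antipode b * antipode a" .
  have "sw b (\<lambda>b1 br. sw br (\<lambda>b2 b3. ?E a1 a2 a3 b1 b2 b3)) = antipode (a1 * b) * a2 * antipode a3" for a1 a2 a3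
    using sw_antipode_cancel(3)[where f = "\<lambda>x y. antipode (a1 * y) * (a2 * x) * antipode a3" and a = b]
    by (simp add: lin mult.assoc)
  then have "sw a (\<lambda>a1 ar. sw ar (\<lambda>a2 a3. sw b (\<lambda>b1 br. sw br (\<lambda>b2 b3. ?E a1 a2 a3 b1 b2 b3))))
    = sw a (\<lambda>a1 ar. sw ar (\<lambda>a2 a3. antipode (a1 * b) * (a2 * antipode a3)))"
    by (simp add: mult.assoc)
  also have "\<dots> = antipode (a * b)"
    using sw_antipode_cancel(3)[where f = "\<lambda>x y. antipode (y * b) * x" and a = a]
    by (simp add: lin mult.assoc)
  finally show ?thesis using 1 by simp
qed

text \<open>The same method for \<open>\<Delta>(S(a)) = S(a2) \<otimes> S(a1)\<close>: the product
  \<open>\<Delta>(S(a1)) (a2 \<otimes> a3) (S(a5) \<otimes> S(a4))\<close> is contracted once from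
  the right, through \<open>a3 S(a4)\<close> and then \<open>a2 S(a5)\<close>, and once from the
  left, through \<open>\<Delta>(S(a1) a2)\<close>.\<close>

lemma sw_antipode_arg:
  assumes f: "cbilinear f"
  shows "sw (antipode a) f = sw a (\<lambda>x y. f (antipode y) (antipode x))"
proof -
  note l = lin clinear_compose[OF cbilinearD(1)[OF f]] clinear_compose[OF cbilinearD(2)[OF f]]
  let ?E = "\<lambda>a1 a2 a3 a4 a5. sw (antipode a1) (\<lambda>x y. f (x * (a2 * antipode a5)) (y * (a3 * antipode a4)))"
  let ?T = "sw a (\<lambda>a1 r. sw r (\<lambda>a2 s. sw s (\<lambda>a3 u. sw u (\<lambda>a4 a5. ?E a1 a2 a3 a4 a5))))"
  have "sw s (\<lambda>a3 u. sw u (\<lambda>a4 a5. ?E a1 a2 a3 a4 a5))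
      = sw (antipode a1) (\<lambda>x y. f (x * (a2 * antipode s)) y)" for a1 a2 s
    by (subst sw_antipode_cancel(2)[where f = "\<lambda>x z. sw (antipode a1) (\<lambda>x' y'. f (x' * (a2 * antipode z)) (y' * x))"])
      (intro l | simp)+
  then have "?T = sw a (\<lambda>a1 r. sw r (\<lambda>a2 s. sw (antipode a1) (\<lambda>x y. f (x * (a2 * antipode s)) y)))"
    by simp
  also have "\<dots> = sw (antipode a) f"
    by (subst sw_antipode_cancel(3)[where f = "\<lambda>w z. sw (antipode z) (\<lambda>x y. f (x * w) y)"])
      (intro l | simp)+
  finally have 1: "?T = sw (antipode a) f" .
  have "?T = sw a (\<lambda>a1 r. sw r (\<lambda>v u. sw v (\<lambda>a2 a3. sw u (\<lambda>a4 a5. ?E a1 a2 a3 a4 a5))))"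
  proof -
    have "sw r (\<lambda>a2 s. sw s (\<lambda>a3 u. sw u (\<lambda>a4 a5. ?E a1 a2 a3 a4 a5)))
      = sw r (\<lambda>v u. sw v (\<lambda>a2 a3. sw u (\<lambda>a4 a5. ?E a1 a2 a3 a4 a5)))" for a1 r
      by (rule sw_coassoc[symmetric]; intro l)
    then show ?thesis by simp
  qed
  also have "\<dots> = sw a (\<lambda>a1 r. sw r (\<lambda>v u. sw (antipode a1 * v)
      (\<lambda>x y. sw u (\<lambda>a4 a5. f (x * antipode a5) (y * antipode a4)))))"
  proof -
    have "sw v (\<lambda>a2 a3. sw u (\<lambda>a4 a5. ?E a1 a2 a3 a4 a5))
      = sw (antipode a1 * v) (\<lambda>x y. sw u (\<lambda>a4 a5. f (x * antipode a5) (y * antipode a4)))" for a1 v u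
    proof -
      have "sw v (\<lambda>a2 a3. sw u (\<lambda>a4 a5. ?E a1 a2 a3 a4 a5)) = sw v (\<lambda>a2 a3. sw (antipode a1)
          (\<lambda>x y. sw u (\<lambda>a4 a5. f (x * (a2 * antipode a5)) (y * (a3 * antipode a4)))))"
        by (subst tensor_sum_swap) simp
      also have "\<dots> = sw (antipode a1) (\<lambda>x y. sw v (\<lambda>a2 a3.
          sw u (\<lambda>a4 a5. f (x * (a2 * antipode a5)) (y * (a3 * antipode a4)))))"
        by (rule tensor_sum_swap)
      also have "\<dots> = sw (antipode a1 * v) (\<lambda>x y. sw u (\<lambda>a4 a5. f (x * antipode a5) (y * antipode a4)))"
        by (subst sw_mult) (intro l | simp add: mult.assoc)+
      finally show ?thesis .
    qed
    then show ?thesis by simp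
  qed
  also have "\<dots> = sw a (\<lambda>a4 a5. f (antipode a5) (antipode a4))"
    by (subst sw_antipode_cancel(1)[where f = "\<lambda>w u. sw w (\<lambda>x y. sw u (\<lambda>a4 a5. f (x * antipode a5) (y * antipode a4)))"])
      (intro l | simp add: sw_one[OF cbilinearI] l)+
  finally show ?thesis using 1 by simp
qed

section \<open>Hopf algebra maps and coinvariants\<close>

text \<open>With \<open>W = {0}\<close> this is also how vanishing of a linear map on a span is
  proved below.\<close>

lemma cspan_linear_in:
  assumes "x \<in> cspan S" "clinear L" "csubspace W" "\<And>s. s \<in> S \<Longrightarrow> L s \<in> W"
  shows "L x \<in> W"
  using assms(1)
proof (induction rule: complex_vector.span_induct_alt)
  case base
  show ?case using assms(3) by (simp add: clinear_zero[OF assms(2)] complex_vector.subspace_0)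
next
  case (step c s y)
  then show ?case
    using assms by (simp add: clinear_add[OF assms(2)] clinear_scale[OF assms(2)]
        complex_vector.subspace_add complex_vector.subspace_scale)
qed

lemma csubspace_cspan: "csubspace (cspan S)"
  by (rule complex_vector.subspace_span)

lemma csubspace_vimage: "clinear L \<Longrightarrow> csubspace W \<Longrightarrow> csubspace {x. L x \<in> W}"
  by (auto simp: complex_vector.subspace_def clinear_add clinear_scale clinear_zero)

lemma tensor_subspace_linear_in:
  assumes "t \<in> tensor_subspace X Y" "clinear L" "csubspace W"
    "\<And>x y. x \<in> X \<Longrightarrow> y \<in> Y \<Longrightarrow> L (x \<otimes> y) \<in> W"
  shows "L t \<in> W"
  using assms(1) unfolding tensor_subspace_def
  by (rule cspan_linear_in[OF _ assms(2,3)]) (use assms(4) in auto)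

lemma aug_in_aug_part: "1 \<in> W \<Longrightarrow> csubspace W \<Longrightarrow> a \<in> W \<Longrightarrow> aug a \<in> aug_part W"
  unfolding aug_def aug_part_def
  by (simp add: complex_vector.subspace_diff complex_vector.subspace_scale
      clinear_diff[OF clinear_counit] clinear_scale[OF clinear_counit] counit_one scaleC_complex_def)

locale hopf_map =
  fixes \<pi> :: "'a::hopf_algebra \<Rightarrow> 'h::hopf_algebra"
  assumes hom: "hopf_algebra_hom \<pi>"
begin

abbreviation B where "B \<equiv> coinvariants \<pi>"

lemma clinear_pi: "clinear \<pi>"
  and pi_one: "\<pi> 1 = 1"
  and pi_mult: "\<pi> (a * b) = \<pi> a * \<pi> b"
  and pi_comult: "comult (\<pi> a) = tensor_map \<pi> \<pi> (comult a)"
  and pi_antipode: "\<pi> (antipode a) = antipode (\<pi> a)"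
  using hom unfolding hopf_algebra_hom_def by auto

lemma clinear_pi_comp [lin]: "clinear f \<Longrightarrow> clinear (\<lambda>x. \<pi> (f x))"
  by (rule clinear_compose[OF clinear_pi])

lemma sw_pi: "cbilinear f \<Longrightarrow> sw (\<pi> a) f = sw a (\<lambda>x y. f (\<pi> x) (\<pi> y))"
  by (simp add: pi_comult tensor_sum_tensor_map clinear_pi)

lemma coact_R_eq: "coact_R \<pi> a = sw a (\<lambda>x y. x \<otimes> \<pi> y)"
  by (simp add: coact_R_def tensor_map_def)

lemma clinear_coact_R [lin]: "clinear f \<Longrightarrow> clinear (\<lambda>x. coact_R \<pi> (f x))"
  unfolding coact_R_eq by (intro lin)

lemma csubspace_coinvariants: "csubspace B"
proof -
  have "csubspace {a. coact_R \<pi> a - a \<otimes> 1 \<in> {0}}"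
    by (rule csubspace_vimage) (intro lin complex_vector.subspace_single_0)+
  then show ?thesis by (simp add: coinvariants_def)
qed

lemma one_coinvariant: "1 \<in> B"
  unfolding coinvariants_def coact_R_eq
  by (simp, subst sw_one) (intro lin | simp add: pi_one)+

lemma aug_coinvariant: "b \<in> B \<Longrightarrow> aug b \<in> aug_part B"
  by (rule aug_in_aug_part[OF one_coinvariant csubspace_coinvariants])

lemma sw_coinvariant:
  assumes "b \<in> B" "cbilinear f"
  shows "sw b (\<lambda>x y. f x (\<pi> y)) = f b 1"
proof -
  have "sw b (\<lambda>x y. f x (\<pi> y)) = tensor_sum (coact_R \<pi> b) f"
    unfolding coact_R_def by (subst tensor_sum_tensor_map) (intro lin clinear_pi assms | simp)+
  also have "\<dots> = f b 1"
    using assms by (simp add: coinvariants_def tensor_sum_tensor_of)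
  finally show ?thesis .
qed

text \<open>Apply the counit to the first leg of
  \<open>b1 \<otimes> \<pi>(b2) = b \<otimes> 1\<close>.\<close>

lemma pi_coinvariant: "b \<in> B \<Longrightarrow> \<pi> b = counit b *\<^sub>C 1"
  using sw_coinvariant[of b "\<lambda>x y. counit x *\<^sub>C y"] sw_counit(1)[OF clinear_pi, of b]
  by (simp add: lin)

lemma sw3_coinvariant:
  assumes "b \<in> B" "\<And>y z. clinear (\<lambda>x. f x y z)" "\<And>x z. clinear (\<lambda>y. f x y z)" "\<And>x y. clinear (\<lambda>z. f x y z)"
  shows "sw b (\<lambda>x r. sw r (\<lambda>y z. f x y (\<pi> z))) = sw b (\<lambda>x y. f x y 1)"
proof -
  have "sw b (\<lambda>x r. sw r (\<lambda>y z. f x y (\<pi> z))) = sw b (\<lambda>u z. sw u (\<lambda>x y. f x y (\<pi> z)))"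
    by (rule sw_coassoc[symmetric]; intro assms clinear_compose[OF assms(4)] lin)
  also have "\<dots> = sw b (\<lambda>x y. f x y 1)"
    by (rule sw_coinvariant[OF assms(1)]) (intro lin assms)
  finally show ?thesis .
qed

text \<open>By definition \<open>B\<close> is the kernel of \<open>?\<phi>\<close>, and
  \<open>sw3_coinvariant\<close> says that \<open>\<Delta>(b)\<close> is annihilated by
  \<open>?\<phi>\<close> in the second leg.\<close>

lemma comult_coinvariant:
  assumes "b \<in> B"
  shows "comult b \<in> tensor_subspace UNIV B"
proof -
  let ?\<phi> = "\<lambda>y. coact_R \<pi> y - y \<otimes> 1"
  have \<phi>: "clinear ?\<phi>" by (intro lin)
  have "tensor_map id ?\<phi> (comult b)
      = sw b (\<lambda>x y. sw y (\<lambda>y1 y2. x \<otimes> y1 \<otimes> \<pi> y2)) - sw b (\<lambda>x y. x \<otimes> y \<otimes> 1)"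
    unfolding tensor_map_def coact_R_eq
    by (simp add: clinear_diff[OF clinear_tensor_of(2)[OF clinear_ident(1)]] tensor_sum_diff
        tensor_sum_linear[OF clinear_tensor_of(2)[OF clinear_ident(1)]])
  also have "\<dots> = 0"
    by (subst sw3_coinvariant[OF assms]) (intro lin | simp)+
  finally show ?thesis
    using tensor_map_id_kernel[OF \<phi>] by (simp add: coinvariants_def)
qed

lemma sw_coinvariant_cong:
  assumes "b \<in> B" "cbilinear f" "cbilinear g" "\<And>x y. y \<in> B \<Longrightarrow> f x y = g x y"
  shows "sw b f = sw b g"
proof -
  have "clinear (\<lambda>t. tensor_sum t f - tensor_sum t g)"
    by (intro lin assms)
  from tensor_subspace_linear_in[OF comult_coinvariant[OF assms(1)] this complex_vector.subspace_single_0]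
  show ?thesis
    using assms by (simp add: tensor_sum_tensor_of)
qed

section \<open>The canonical map and the kernel of \<open>\<pi>\<close>\<close>

lemma clinear_canonical_map: "clinear (canonical_map \<pi>)"
  unfolding canonical_map_def by (intro lin)

lemma canonical_map_balanced:
  assumes "t \<in> balanced B UNIV (*)"
  shows "canonical_map \<pi> t = 0"
proof -
  have "canonical_map \<pi> ((a * b) \<otimes> m) = canonical_map \<pi> (a \<otimes> (b * m))" if "b \<in> B" for a b m
  proof -
    have *: "canonical_map \<pi> (x \<otimes> y) = sw y (\<lambda>y1 y2. (x * y1) \<otimes> \<pi> y2)" for x y
      unfolding canonical_map_def by (rule tensor_sum_tensor_of) (intro lin)
    have "canonical_map \<pi> (a \<otimes> (b * m)) = sw b (\<lambda>b1 b2. sw m (\<lambda>m1 m2. (a * (b1 * m1)) \<otimes> (\<pi> b2 * \<pi> m2)))"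
      unfolding * by (subst sw_mult) (intro lin | simp add: pi_mult)+
    also have "\<dots> = sw m (\<lambda>m1 m2. (a * (b * m1)) \<otimes> (1 * \<pi> m2))"
      by (rule sw_coinvariant[OF that]) (intro lin)
    finally show ?thesis by (simp add: * mult.assoc)
  qed
  then have "canonical_map \<pi> t \<in> {0}"
    by (intro cspan_linear_in[OF assms[unfolded balanced_def] clinear_canonical_map
          complex_vector.subspace_single_0])
      (auto simp: clinear_diff[OF clinear_canonical_map])
  then show ?thesis by simp
qed

lemma canonical_map_kernel:
  assumes galois: "hopf_galois \<pi>" and t: "canonical_map \<pi> t = 0"
  shows "t \<in> balanced B UNIV (*)"
proof -
  let ?N = "balanced B UNIV (*)"
  let ?R = "{(s, t). s - t \<in> ?N}"
  let ?f = "\<lambda>X. the_elem (canonical_map \<pi> ` X)"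
  have N: "csubspace ?N" unfolding balanced_def by (rule csubspace_cspan)
  have coset: "?R `` {s} \<in> UNIV // ?R" for s by (rule quotientI) simp
  have self: "s \<in> ?R `` {s}" for s using N by (simp add: complex_vector.subspace_0)
  \<comment> \<open>The map is constant on cosets, so \<open>the_elem\<close> returns its value on
    any representative and injectivity on cosets becomes a statement about the kernel.\<close>
  have "canonical_map \<pi> ` (?R `` {s}) = {canonical_map \<pi> s}" for s
  proof -
    have "canonical_map \<pi> u = canonical_map \<pi> s" if "s - u \<in> ?N" for u
      using canonical_map_balanced[OF that] by (simp add: clinear_diff[OF clinear_canonical_map])
    then have "canonical_map \<pi> ` (?R `` {s}) \<subseteq> {canonical_map \<pi> s}"
      by (intro image_subsetI) (simp only: Image_singleton_iff mem_Collect_eq prod.case singleton_iff)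
    then show ?thesis using self[of s] by blast
  qed
  then have "?f (?R `` {0}) = ?f (?R `` {t})"
    by (simp only: t clinear_zero[OF clinear_canonical_map])
  then have "?R `` {0} = ?R `` {t}"
    using galois coset unfolding hopf_galois_def bij_betw_def inj_on_def by metis
  then have "0 - t \<in> ?N" using self[of t] by auto
  then show ?thesis using complex_vector.subspace_neg[OF N] by fastforce
qed

text \<open>The canonical map sends \<open>S(a\<^sub>(\<^sub>1\<^sub>)) \<otimes> a\<^sub>(\<^sub>2\<^sub>)\<close> to \<open>1 \<otimes> \<pi>(a)\<close>.\<close>

lemma pi_kernel:
  assumes galois: "hopf_galois \<pi>" and a: "\<pi> a = 0"
  shows "a \<in> cspan {b * x | b x. b \<in> aug_part B}"
proof -
  let ?W = "cspan {b * x | b x. b \<in> aug_part B}"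
  let ?t = "sw a (\<lambda>x y. antipode x \<otimes> y)"
  let ?L = "\<lambda>t. tensor_sum t (\<lambda>x y. counit x *\<^sub>C y)"
  have "canonical_map \<pi> ?t = sw a (\<lambda>x y. sw y (\<lambda>y1 y2. (antipode x * y1) \<otimes> \<pi> y2))"
    unfolding canonical_map_def
    by (subst tensor_sum_tensor_sum, intro lin, subst tensor_sum_tensor_of) (intro lin | rule refl)+
  also have "\<dots> = 1 \<otimes> \<pi> a"
    by (rule sw_antipode_cancel(1)) (intro lin)+
  finally have "?t \<in> balanced B UNIV (*)"
    by (intro canonical_map_kernel[OF galois])
      (simp add: a clinear_zero[OF clinear_tensor_of(2)[OF clinear_ident(1)]])
  moreover have L: "clinear ?L" by (intro lin)
  \<comment> \<open>Applying \<open>\<epsilon> \<otimes> id\<close> turns a balancing relation into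
    a multiple of \<open>aug b * m\<close>, while it sends \<open>?t\<close> back to
    \<open>a\<close>.\<close>
  moreover have "?L ((x * b) \<otimes> m - x \<otimes> (b * m)) \<in> ?W" if "b \<in> B" for x b m
  proof -
    have "?L ((x * b) \<otimes> m - x \<otimes> (b * m)) = (- counit x) *\<^sub>C (aug b * m)"
      by (simp add: clinear_diff[OF L] tensor_sum_tensor_of lin counit_mult aug_def algebra_simps
          mult_scaleC_left complex_vector.scale_right_diff_distrib scaleC_scaleC)
    moreover have "aug b * m \<in> ?W"
      by (rule complex_vector.span_base) (use aug_coinvariant[OF that] in blast)
    ultimately show ?thesis
      by (simp add: complex_vector.span_scale del: complex_vector.scale_minus_left)
  qed
  ultimately have "?L ?t \<in> ?W"
    unfolding balanced_def by (elim cspan_linear_in[OF _ L csubspace_cspan]) auto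
  moreover have "?L ?t = a"
    by (subst tensor_sum_tensor_sum) (intro lin | simp add: tensor_sum_tensor_of lin counit_antipode counit_left)+
  ultimately show ?thesis by simp
qed

end

section \<open>Flatness\<close>

text \<open>The counit is onto the complex numbers, since it maps \<open>z *\<^sub>C 1\<close> to
  \<open>z\<close>.\<close>

lemma hopf_algebra_infinite: "infinite (UNIV :: 'a::hopf_algebra set)"
proof
  assume "finite (UNIV :: 'a set)"
  then have "finite (range (counit :: 'a \<Rightarrow> complex))" by simp
  moreover have "range (counit :: 'a \<Rightarrow> complex) = UNIV"
  proof -
    have "counit (z *\<^sub>C (1::'a)) = z" for z
      by (simp add: clinear_scale[OF clinear_counit] counit_one scaleC_complex_def)
    then show ?thesis by (rule surjI)
  qed
  ultimately show False by (simp add: infinite_UNIV_char_0)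
qed

text \<open>\<open>faithfully_flat\<close> ranges over subspaces of
  \<open>'a \<Rightarrow>\<^sub>0 complex\<close>, so the space of forms has to be placed there. A
  basis taken from the generators \<open>f a b\<close> is indexed by pairs, and pairs inject into
  the infinite set of elements of \<open>'a\<close>.\<close>

lemma linear_embedding_poly_mapping:
  fixes f :: "'a::hopf_algebra \<Rightarrow> 'a \<Rightarrow> 'w::complex_vector"
  assumes span: "cspan {f a b | a b. True} = UNIV"
  obtains e :: "'w \<Rightarrow> ('a \<Rightarrow>\<^sub>0 complex)" and r where "clinear e" "clinear r" "\<And>w. r (e w) = w"
proof -
  obtain X where X: "X \<subseteq> {f a b | a b. True}" "complex_vector.independent X" "UNIV \<subseteq> cspan X"
    using complex_vector.maximal_independent_subset[of "{f a b | a b. True}"] span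
      complex_vector.span_mono complex_vector.span_span
    by (metis (no_types, lifting) subset_UNIV subset_antisym)
  include cardinal_syntax
  have "|UNIV \<times> UNIV :: ('a \<times> 'a) set| \<le>o |UNIV :: 'a set|"
    using card_of_Times_same_infinite[OF hopf_algebra_infinite] ordIso_iff_ordLeq by blast
  then obtain j :: "'a \<times> 'a \<Rightarrow> 'a" where j: "inj j"
    unfolding card_of_ordLeq[symmetric] by auto
  have "\<forall>x\<in>X. \<exists>q. x = f (fst q) (snd q)"
    using X(1) by fastforce
  then obtain q where q: "\<forall>x\<in>X. x = f (fst (q x)) (snd (q x))"
    by (rule bchoice[THEN exE])
  \<comment> \<open>\<open>k\<close> labels the basis vector \<open>x\<close> by an element of
    \<open>'a\<close>; it is injective because \<open>q x\<close> determines
    \<open>x\<close>.\<close>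
  define k where "k x = j (q x)" for x
  have k: "inj_on k X"
    by (rule inj_onI) (metis q k_def j injD)
  \<comment> \<open>Labels not of the form \<open>k x\<close> receive an arbitrary value, which does
    not affect \<open>r (e x)\<close> for \<open>x\<close> in the basis.\<close>
  define r :: "('a \<Rightarrow>\<^sub>0 complex) \<Rightarrow> 'w"
    where "r p = (\<Sum>y\<in>Poly_Mapping.keys p. Poly_Mapping.lookup p y *\<^sub>C inv_into X k y)" for p
  have r_sup: "r p = (\<Sum>y\<in>K. Poly_Mapping.lookup p y *\<^sub>C inv_into X k y)"
    if "finite K" "Poly_Mapping.keys p \<subseteq> K" for p K
    unfolding r_def by (rule sum.mono_neutral_left) (use that in \<open>auto simp: in_keys_iff\<close>)
  have r: "clinear r"
  proof (rule clinearI)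
    fix p q :: "'a \<Rightarrow>\<^sub>0 complex" and c :: complex
    let ?K = "Poly_Mapping.keys p \<union> Poly_Mapping.keys q"
    show "r (p + q) = r p + r q"
      using Poly_Mapping.keys_add[of p q]
      by (simp add: r_sup[of ?K] lookup_add scaleC_add_left sum.distrib)
    have "Poly_Mapping.keys (c *\<^sub>C p) \<subseteq> Poly_Mapping.keys p"
      by (auto simp: in_keys_iff lookup_scaleC scaleC_complex_def)
    then show "r (c *\<^sub>C p) = c *\<^sub>C r p"
      by (simp add: r_sup[of "Poly_Mapping.keys p"] lookup_scaleC scaleC_complex_def
          complex_vector.scale_sum_right scaleC_scaleC)
  qed
  obtain e :: "'w \<Rightarrow> ('a \<Rightarrow>\<^sub>0 complex)" where e: "clinear e" "\<forall>x\<in>X. e x = Poly_Mapping.single (k x) 1"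
    using complex_vector_pair.linear_independent_extend[OF X(2)] by meson
  have "r (e w) = w" for w
  proof -
    have "r (e x) = x" if "x \<in> X" for x
      using that e(2) k by (simp add: r_def scaleC_one)
    then show ?thesis
      using complex_vector_pair.linear_eq_on[OF clinear_compose[OF r e(1)] clinear_ident(1), of w X] X(3)
      by auto
  qed
  then show ?thesis using that e(1) r by blast
qed

text \<open>Injectivity of \<open>A \<otimes>\<^sub>B M -> A \<otimes>\<^sub>B W\<close> for a
  submodule \<open>M\<close> of the whole space \<open>W\<close>, stated in terms of balancing
  relations. The modules are transported along \<open>e\<close> so that the flatness hypothesis
  applies.\<close>

lemma flat_balanced:
  fixes act :: "'a::hopf_algebra \<Rightarrow> 'w::complex_vector \<Rightarrow> 'w" and e :: "'w \<Rightarrow> ('a \<Rightarrow>\<^sub>0 complex)"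
  assumes flat: "faithfully_flat B"
    and act: "cbilinear act" "\<And>w. act 1 w = w" "\<And>a b w. act (a * b) w = act a (act b w)"
    and er: "clinear e" "clinear r" "\<And>w. r (e w) = w"
    and M: "csubspace M" "\<And>b m. b \<in> B \<Longrightarrow> m \<in> M \<Longrightarrow> act b m \<in> M"
    and t: "t \<in> tensor_subspace UNIV M" "t \<in> balanced B UNIV act"
  shows "t \<in> balanced B M act"
proof -
  define act' where "act' b m = e (act b (r m))" for b m
  have bal: "csubspace (balanced C X f)" for C :: "'a set" and X :: "'x::complex_vector set" and f
    unfolding balanced_def by (rule csubspace_cspan)
  have act_add: "act (b + c) w = act b w + act c w" "act b (w + w') = act b w + act b w'"
    "act (z *\<^sub>C b) w = z *\<^sub>C act b w" "act b (z *\<^sub>C w) = z *\<^sub>C act b w" for b c w w' z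
    using clinear_add[OF cbilinearD(2)[OF act(1)]] clinear_add[OF cbilinearD(1)[OF act(1)]]
      clinear_scale[OF cbilinearD(2)[OF act(1)]] clinear_scale[OF cbilinearD(1)[OF act(1)]] by auto
  have mod: "left_module_on B (e ` X) act'" if "csubspace X" "\<And>b m. b \<in> B \<Longrightarrow> m \<in> X \<Longrightarrow> act b m \<in> X" for X
    unfolding left_module_on_def act'_def
    using that(2) complex_vector_pair.linear_subspace_image[OF er(1) that(1)]
    by (auto simp: er act act_add clinear_add[OF er(1)] clinear_add[OF er(2)] clinear_scale[OF er(1)]
        clinear_scale[OF er(2)])
  have zero: "act b 0 = 0" for b
    using clinear_zero[OF cbilinearD(1)[OF act(1)]] .
  have "left_module_on B (e ` {0}) act'" "left_module_on B (e ` M) act'" "left_module_on B (range e) act'"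
    by (rule mod; use M zero complex_vector.subspace_single_0 in auto)+
  moreover have "left_module_hom_on B (e ` {0}) act' (e ` M) act' id"
    "left_module_hom_on B (e ` M) act' (range e) act' id"
    using complex_vector.subspace_0[OF M(1)] by (auto simp: left_module_hom_on_def lin)
  \<comment> \<open>Exactness of \<open>0 -> M -> W\<close> at \<open>M\<close>, with both maps the
    identity of the ambient space.\<close>
  moreover have "\<forall>m\<in>e ` M. id m = 0 \<longleftrightarrow> m \<in> id ` (e ` {0})"
    by (simp add: clinear_zero[OF er(1)])
  ultimately have exact: "\<forall>t\<in>tensor_subspace UNIV (e ` M). tensor_map id id t \<in> balanced B (range e) act' \<longleftrightarrow>
      (\<exists>s\<in>tensor_subspace UNIV (e ` {0}). t - tensor_map id id s \<in> balanced B (e ` M) act')"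
    using flat[unfolded faithfully_flat_def, THEN spec[of _ "e ` {0}"], THEN spec[of _ "e ` M"],
        THEN spec[of _ "range e"], THEN spec[of _ act'], THEN spec[of _ act'], THEN spec[of _ act'],
        THEN spec[of _ id], THEN spec[of _ id]]
    by metis
  let ?t = "tensor_map id e t"
  have le: "clinear (\<lambda>t. tensor_map id e t)" and lr: "clinear (\<lambda>t. tensor_map id r t)"
    by (intro lin er)+
  have "?t \<in> tensor_subspace UNIV (e ` M)"
    by (rule tensor_subspace_linear_in[OF t(1) le csubspace_tensor_subspace])
      (auto simp: tensor_map_tensor_of er lin intro: tensor_of_in_subspace)
  moreover have "?t \<in> balanced B (range e) act'"
  proof -
    have "tensor_map id e ((a * b) \<otimes> m - a \<otimes> act b m) \<in> balanced B (range e) act'" if "b \<in> B" for a b m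
    proof -
      have "tensor_map id e ((a * b) \<otimes> m - a \<otimes> act b m) = (a * b) \<otimes> e m - a \<otimes> act' b (e m)"
        by (simp add: clinear_diff[OF le] tensor_map_tensor_of er lin act'_def)
      then show ?thesis
        unfolding balanced_def by (simp only:) (rule complex_vector.span_base, use that in blast)
    qed
    then show ?thesis
      by (intro cspan_linear_in[OF t(2)[unfolded balanced_def] le bal]) auto
  qed
  ultimately obtain s where s: "s \<in> tensor_subspace UNIV (e ` {0})" "?t - s \<in> balanced B (e ` M) act'"
    using exact by (auto simp: tensor_map_ident[folded id_def])
  have "s = 0"
    using tensor_subspace_linear_in[OF s(1) clinear_ident(1) complex_vector.subspace_single_0]
    by (simp add: clinear_zero[OF er(1)] clinear_zero[OF clinear_tensor_of(2)[OF clinear_ident(1)]])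
  then have "?t \<in> cspan {(a * b) \<otimes> m - a \<otimes> act' b m | a b m. b \<in> B \<and> m \<in> e ` M}"
    using s(2) by (simp add: balanced_def)
  then have "tensor_map id r ?t \<in> balanced B M act"
  proof (rule cspan_linear_in[OF _ lr bal], safe)
    fix a b m assume "b \<in> B" "m \<in> M"
    moreover have "tensor_map id r ((a * b) \<otimes> e m - a \<otimes> act' b (e m)) = (a * b) \<otimes> m - a \<otimes> act b m"
      by (simp add: clinear_diff[OF lr] tensor_map_tensor_of er lin act'_def)
    ultimately show "tensor_map id r ((a * b) \<otimes> e m - a \<otimes> act' b (e m)) \<in> balanced B M act"
      unfolding balanced_def
      by (simp only:) (rule complex_vector.span_base, use \<open>b \<in> B\<close> \<open>m \<in> M\<close> in blast)
  qed
  moreover have "tensor_map id r ?t = t"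
    by (simp add: tensor_map_tensor_map er lin tensor_map_ident)
  ultimately show ?thesis by simp
qed

section \<open>Left-covariant calculi and their fibres\<close>

locale principal_bundle = hopf_map \<pi>
  for \<pi> :: "'a::hopf_algebra \<Rightarrow> 'h::hopf_algebra" +
  fixes \<Omega> :: "('a, 'w::complex_vector) calculus"
    and \<delta> :: "'w \<Rightarrow> 'a \<otimes> 'w"
    and \<rho> :: "'w \<Rightarrow> 'w \<otimes> 'h"
    and qF :: "'w \<Rightarrow> 'f::complex_vector"
  assumes qpb: "quantum_principal_bundle \<pi> \<Omega> \<delta> \<rho>"
    and F: "is_F \<Omega> qF"
begin

abbreviation L where "L \<equiv> lact \<Omega>"
abbreviation R where "R \<equiv> ract \<Omega>"
abbreviation D where "D \<equiv> diff \<Omega>"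
abbreviation clsF where "clsF \<equiv> cls \<Omega> qF"
abbreviation actF where "actF \<equiv> F_act \<Omega> qF"

lemma galois: "hopf_galois \<pi>" and calc: "fodc \<Omega>"
  and left: "left_covariant \<Omega> \<delta>" and right: "right_covariant \<pi> \<Omega> \<rho>"
  using qpb unfolding quantum_principal_bundle_def by auto

lemma L_bilinear: "cbilinear L" and R_bilinear: "cbilinear R" and clinear_D: "clinear D"
  and L_one: "L 1 w = w" and L_mult: "L (a * b) w = L a (L b w)"
  and R_one: "R w 1 = w" and R_mult: "R w (a * b) = R (R w a) b"
  and R_L: "R (L a w) b = L a (R w b)"
  and D_mult: "D (a * b) = R (D a) b + L a (D b)"
  and forms_span: "cspan {L a (D b) | a b. True} = UNIV"
  using calc unfolding fodc_def by (auto 0 0)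

lemma clinear_calculus [lin]:
  assumes "clinear f"
  shows "clinear (\<lambda>x. L (f x) w)" "clinear (\<lambda>x. R w' (f x))" "clinear (\<lambda>x. D (f x))"
  by (rule clinear_compose[OF cbilinearD(2)[OF L_bilinear] assms]
      clinear_compose[OF cbilinearD(1)[OF R_bilinear] assms] clinear_compose[OF clinear_D assms])+

lemma clinear_calculus' [lin]:
  assumes "clinear f"
  shows "clinear (\<lambda>x. L a (f x))" "clinear (\<lambda>x. R (f x) a)"
  by (rule clinear_compose[OF cbilinearD(1)[OF L_bilinear] assms]
      clinear_compose[OF cbilinearD(2)[OF R_bilinear] assms])+

lemma form_in:
  assumes "clinear f" "csubspace W" "\<And>a b. f (L a (D b)) \<in> W"
  shows "f w \<in> W"
  by (rule cspan_linear_in[of w "{L a (D b) | a b. True}", OF _ assms(1,2)])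
    (use assms(3) forms_span in auto)

lemma form_eqI:
  assumes "clinear f" "clinear g" "\<And>a b. f (L a (D b)) = g (L a (D b))"
  shows "f w = g w"
  using form_in[OF clinear_plus_minus(2)[OF assms(1,2)] complex_vector.subspace_single_0, of w]
  by (simp add: assms(3))

section \<open>Coactions on one-forms and the coinvariant projection\<close>

lemma clinear_\<delta>: "clinear \<delta>"
  and \<delta>_coassoc: "tensor_assoc (tensor_map comult id (\<delta> w)) = tensor_map id \<delta> (\<delta> w)"
  and \<delta>_counit: "tensor_sum (\<delta> w) (\<lambda>a w. counit a *\<^sub>C w) = w"
  using left unfolding left_covariant_def left_coaction_def by auto

lemma clinear_\<rho>: "clinear \<rho>"
  and \<rho>_coassoc: "tensor_assoc (tensor_map \<rho> id (\<rho> w)) = tensor_map id comult (\<rho> w)"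
  and \<rho>_counit: "tensor_sum (\<rho> w) (\<lambda>w h. counit h *\<^sub>C w) = w"
  using right unfolding right_covariant_def right_coaction_def by auto

lemma clinear_coactions [lin]:
  assumes "clinear f"
  shows "clinear (\<lambda>x. \<delta> (f x))" "clinear (\<lambda>x. \<rho> (f x))"
  by (rule clinear_compose[OF clinear_\<delta> assms] clinear_compose[OF clinear_\<rho> assms])+

lemma \<delta>_form:
  assumes "cbilinear f"
  shows "tensor_sum (\<delta> (L b (D c))) f = sw b (\<lambda>b1 b2. sw c (\<lambda>c1 c2. f (b1 * c1) (L b2 (D c2))))"
  using left unfolding left_covariant_def
  by (simp add: tensor_sum_tensor_sum[OF assms] tensor_sum_tensor_of[OF assms])

lemma \<delta>_D:
  assumes "cbilinear f"
  shows "tensor_sum (\<delta> (D c)) f = sw c (\<lambda>c1 c2. f c1 (D c2))"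
proof -
  note l = lin clinear_compose[OF cbilinearD(1)[OF assms]] clinear_compose[OF cbilinearD(2)[OF assms]]
  show ?thesis
    using \<delta>_form[OF assms, of 1 c]
    by (subst (asm) sw_one) (intro l | simp add: L_one)+
qed

text \<open>Covariance prescribes the coaction only on \<open>b dc\<close>; these forms span, which
  gives compatibility with left multiplication on all forms.\<close>

lemma \<delta>_L:
  assumes "cbilinear f"
  shows "tensor_sum (\<delta> (L a w)) f = sw a (\<lambda>a1 a2. tensor_sum (\<delta> w) (\<lambda>x y. f (a1 * x) (L a2 y)))"
proof (rule form_eqI)
  note l = lin assms clinear_compose[OF cbilinearD(1)[OF assms]] clinear_compose[OF cbilinearD(2)[OF assms]]
  show "clinear (\<lambda>w. tensor_sum (\<delta> (L a w)) f)"
    "clinear (\<lambda>w. sw a (\<lambda>a1 a2. tensor_sum (\<delta> w) (\<lambda>x y. f (a1 * x) (L a2 y))))"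
    by (intro l)+
  fix b c
  have "tensor_sum (\<delta> (L a (L b (D c)))) f
      = sw a (\<lambda>a1 a2. sw b (\<lambda>b1 b2. sw c (\<lambda>c1 c2. f (a1 * b1 * c1) (L (a2 * b2) (D c2)))))"
    unfolding L_mult[symmetric] \<delta>_form[OF assms] by (rule sw_mult) (intro l)
  also have "\<dots> = sw a (\<lambda>a1 a2. tensor_sum (\<delta> (L b (D c))) (\<lambda>x y. f (a1 * x) (L a2 y)))"
    by (subst \<delta>_form) (intro l | simp add: L_mult mult.assoc)+
  finally show "tensor_sum (\<delta> (L a (L b (D c)))) f
      = sw a (\<lambda>a1 a2. tensor_sum (\<delta> (L b (D c))) (\<lambda>x y. f (a1 * x) (L a2 y)))" .
qed

definition \<theta> :: "'w \<Rightarrow> 'w"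
  where "\<theta> w = tensor_sum (\<delta> w) (\<lambda>x y. L (antipode x) y)"

lemma clinear_\<theta> [lin]: "clinear f \<Longrightarrow> clinear (\<lambda>x. \<theta> (f x))"
  unfolding \<theta>_def by (intro lin)

text \<open>Anti-multiplicativity of the antipode brings \<open>S(a1)\<close> next to
  \<open>a2\<close>.\<close>

lemma \<theta>_L: "\<theta> (L a w) = counit a *\<^sub>C \<theta> w"
proof -
  have "\<theta> (L a w) = sw a (\<lambda>a1 a2. tensor_sum (\<delta> w) (\<lambda>x y. L (antipode x) (L (antipode a1 * a2) y)))"
    unfolding \<theta>_def by (subst \<delta>_L) (intro lin | simp add: antipode_mult L_mult[symmetric] mult.assoc)+
  also have "\<dots> = counit a *\<^sub>C tensor_sum (\<delta> w) (\<lambda>x y. L (antipode x) (L 1 y))"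
    by (rule sw_antipode(1)) (intro lin)
  finally show ?thesis by (simp add: L_one \<theta>_def)
qed

text \<open>The surjective half of the fundamental theorem of Hopf modules: after coassociativity
  the two coefficients contract as \<open>u S(v)\<close>.\<close>

lemma form_reconstruct: "tensor_sum (\<delta> w) (\<lambda>x y. L x (\<theta> y)) = w"
proof -
  have "tensor_sum (\<delta> w) (\<lambda>x y. L x (\<theta> y)) = tensor_sum (\<delta> w) (\<lambda>x y. tensor_sum (\<delta> y) (\<lambda>u v. L (x * antipode u) v))"
    by (simp add: \<theta>_def tensor_sum_linear[OF clinear_calculus'(1)[OF clinear_ident(1)]] L_mult)
  also have "\<dots> = tensor_sum (\<delta> w) (\<lambda>x z. sw x (\<lambda>u v. L (u * antipode v) z))"
    by (rule assoc_eq_tensor_sum[symmetric, OF _ _ _ clinear_comult clinear_\<delta> \<delta>_coassoc]) (intro lin)+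
  also have "\<dots> = tensor_sum (\<delta> w) (\<lambda>x z. counit x *\<^sub>C L 1 z)"
    by (subst sw_antipode(2)) (intro lin | simp)+
  finally show ?thesis by (simp add: L_one \<delta>_counit)
qed

lemma \<theta>_D: "\<theta> (D a) = sw a (\<lambda>x y. L (antipode x) (D y))"
  unfolding \<theta>_def by (rule \<delta>_D) (intro lin)

section \<open>The fibre and its coinvariant representatives\<close>

lemma clinear_qF: "clinear qF" and surj_qF: "range qF = UNIV"
  and qF_eq_0_iff: "qF w = 0 \<longleftrightarrow> w \<in> left_prod \<Omega> (aug_part UNIV) UNIV"
  using F unfolding is_F_def quotient_map_def by (auto simp: clinear_iff)

lemma clinear_qF_comp [lin]: "clinear f \<Longrightarrow> clinear (\<lambda>x. qF (f x))"
  by (rule clinear_compose[OF clinear_qF])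

lemma qF_L: "qF (L a w) = counit a *\<^sub>C qF w"
proof -
  have "L (aug a) w = L a w - counit a *\<^sub>C w"
    unfolding aug_def using clinear_diff[OF cbilinearD(2)[OF L_bilinear], of a "counit a *\<^sub>C 1"]
      clinear_scale[OF cbilinearD(2)[OF L_bilinear]] by (simp add: L_one)
  moreover have "aug a \<in> aug_part UNIV"
    by (rule aug_in_aug_part) auto
  then have "L (aug a) w \<in> left_prod \<Omega> (aug_part UNIV) UNIV"
    unfolding left_prod_def by (intro complex_vector.span_base) blast
  ultimately have "qF (L a w - counit a *\<^sub>C w) = 0"
    using qF_eq_0_iff by simp
  then show ?thesis
    by (simp add: clinear_diff[OF clinear_qF] clinear_scale[OF clinear_qF])
qed

lemma qF_R_eq_0: "qF w = 0 \<Longrightarrow> qF (R w a) = 0"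
  and \<theta>_eq_0: "qF w = 0 \<Longrightarrow> \<theta> w = 0"
proof -
  assume "qF w = 0"
  then have w: "w \<in> cspan {L x f | x f. x \<in> aug_part UNIV \<and> f \<in> UNIV}"
    by (simp add: qF_eq_0_iff left_prod_def)
  have "qF (R w a) \<in> {0}"
    by (rule cspan_linear_in[OF w _ complex_vector.subspace_single_0])
      (auto intro!: lin simp: R_L qF_L aug_part_def)
  then show "qF (R w a) = 0" by simp
  have "\<theta> w \<in> {0}"
    by (rule cspan_linear_in[OF w _ complex_vector.subspace_single_0])
      (auto intro!: lin simp: \<theta>_L aug_part_def)
  then show "\<theta> w = 0" by simp
qed

lemma qF_\<theta>: "qF (\<theta> w) = qF w"
  unfolding \<theta>_def
  by (simp add: tensor_sum_linear[OF clinear_qF] qF_L counit_antipode clinear_scale[OF clinear_qF, symmetric]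
      tensor_sum_linear[OF clinear_qF, symmetric] \<delta>_counit)

lemma \<theta>_cong: "qF w = qF w' \<Longrightarrow> \<theta> w = \<theta> w'"
  using \<theta>_eq_0[of "w - w'"] clinear_diff[OF clinear_\<theta>[OF clinear_ident(1)]]
  by (simp add: clinear_diff[OF clinear_qF])

lemma \<theta>_\<theta>: "\<theta> (\<theta> w) = \<theta> w"
  by (rule \<theta>_cong) (rule qF_\<theta>)

text \<open>A section of \<open>qF\<close>: \<open>\<theta>\<close> vanishes on the kernel of
  \<open>qF\<close>, so applying it removes the arbitrary choice made by \<open>inv\<close> and
  yields a linear map.\<close>

definition sec :: "'f \<Rightarrow> 'w"
  where "sec x = \<theta> (inv qF x)"

lemma sec_qF: "sec (qF w) = \<theta> w"
  unfolding sec_def by (rule \<theta>_cong) (simp add: surj_qF f_inv_into_f)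

lemma clinear_sec [lin]: "clinear f \<Longrightarrow> clinear (\<lambda>x. sec (f x))"
proof (rule clinear_compose[of sec], rule clinearI)
  fix x y :: 'f and c
  obtain v w where "x = qF v" "y = qF w" by (metis surj_qF surj_def)
  then show "sec (x + y) = sec x + sec y" "sec (c *\<^sub>C x) = c *\<^sub>C sec x"
    using clinear_add[OF clinear_\<theta>[OF clinear_ident(1)]] clinear_scale[OF clinear_\<theta>[OF clinear_ident(1)]]
    by (simp_all add: sec_qF clinear_add[OF clinear_qF, symmetric] clinear_scale[OF clinear_qF, symmetric])
qed

lemma clsF_eq: "clsF a = qF (D a)"
  by (simp add: cls_def)

lemma clinear_clsF [lin]: "clinear f \<Longrightarrow> clinear (\<lambda>x. clsF (f x))"
  unfolding clsF_eq by (intro lin)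

text \<open>The class of \<open>a db\<close> is that of \<open>d(\<epsilon>(a) b)\<close>, so
  classes of exact forms already fill the fibre.\<close>

lemma clsF_surj: obtains a where "x = clsF a"
proof -
  obtain w where w: "x = qF w" by (metis surj_qF surj_def)
  have "qF (L a (D b)) \<in> range clsF" for a b
    using rangeI[of clsF "counit a *\<^sub>C b"]
    by (simp add: qF_L clsF_eq clinear_scale[OF clinear_D] clinear_scale[OF clinear_qF])
  moreover have "csubspace (range clsF)"
    using complex_vector_pair.linear_subspace_image[OF clinear_clsF[OF clinear_ident(1)], of UNIV] by simp
  ultimately have "qF w \<in> range clsF"
    by (rule form_in[OF clinear_qF, rotated])
  then show thesis using that w by auto
qed

section \<open>The right action on the fibre\<close>

lemma actF_qF: "actF (qF w) a = qF (R w a)"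
proof -
  have "qF (inv qF (qF w) - w) = 0"
    by (simp add: clinear_diff[OF clinear_qF] surj_qF f_inv_into_f)
  from qF_R_eq_0[OF this, of a] show ?thesis
    by (simp add: F_act_def clinear_diff[OF cbilinearD(2)[OF R_bilinear]] clinear_diff[OF clinear_qF])
qed

text \<open>The Leibniz rule \<open>(db) a = d(ba) - b da\<close>. The correction disappears for
  \<open>b\<close> in the augmentation ideal, where the action is right multiplication.\<close>

lemma actF_clsF: "actF (clsF b) a = clsF (b * a) - counit b *\<^sub>C clsF a"
  by (simp add: clsF_eq actF_qF D_mult clinear_add[OF clinear_qF] qF_L)

lemma actF_bilinear: "cbilinear actF"
proof (rule cbilinearI)
  fix x a
  obtain w where "x = qF w" by (metis surj_qF surj_def)
  then show "clinear (\<lambda>a. actF x a)" by (simp add: actF_qF lin)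
  have "clinear (\<lambda>x. qF (R (sec x) a))" by (intro lin)
  \<comment> \<open>Replacing \<open>inv qF\<close> by the linear section makes linearity in the
    class visible.\<close>
  moreover have "actF x a = qF (R (sec x) a)" for x
  proof -
    obtain w where w: "x = qF w" by (metis surj_qF surj_def)
    then have "qF (R (sec x - w) a) = 0"
      by (intro qF_R_eq_0) (simp add: clinear_diff[OF clinear_qF] sec_qF qF_\<theta>)
    then show ?thesis
      by (simp add: w actF_qF clinear_diff[OF cbilinearD(2)[OF R_bilinear]] clinear_diff[OF clinear_qF])
  qed
  ultimately show "clinear (\<lambda>x. actF x a)" by simp
qed

lemma clinear_actF [lin]:
  assumes "clinear f"
  shows "clinear (\<lambda>x. actF (f x) a)"
  by (rule clinear_compose[OF cbilinearD(2)[OF actF_bilinear] assms])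

lemma clinear_actF' [lin]:
  assumes "clinear f"
  shows "clinear (\<lambda>u. actF x (f u))"
  by (rule clinear_compose[OF cbilinearD(1)[OF actF_bilinear] assms])

lemma actF_one: "actF x 1 = x" and actF_mult: "actF x (a * b) = actF (actF x a) b"
proof -
  obtain w where "x = qF w" by (metis surj_qF surj_def)
  then show "actF x 1 = x" "actF x (a * b) = actF (actF x a) b"
    by (simp_all add: actF_qF R_one R_mult)
qed

subsection \<open>The adjoint coaction on the fibre\<close>

lemma \<rho>_form: "\<rho> (L b (D c)) = sw b (\<lambda>b1 b2. sw c (\<lambda>c1 c2. L b1 (D c1) \<otimes> (\<pi> b2 * \<pi> c2)))"
proof -
  have "\<rho> (L b (D c)) = tensor_sum (coact_R \<pi> b) (\<lambda>b0 b1. tensor_sum (coact_R \<pi> c) (\<lambda>c0 c1. L b0 (D c0) \<otimes> (b1 * c1)))"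
    using right unfolding right_covariant_def by blast
  also have "\<dots> = sw b (\<lambda>b1 b2. tensor_sum (coact_R \<pi> c) (\<lambda>c0 c1. L b1 (D c0) \<otimes> (\<pi> b2 * c1)))"
    unfolding coact_R_def[of \<pi> b]
    by (subst tensor_sum_tensor_map) (intro lin clinear_pi | simp)+
  also have "\<dots> = sw b (\<lambda>b1 b2. sw c (\<lambda>c1 c2. L b1 (D c1) \<otimes> (\<pi> b2 * \<pi> c2)))"
  proof -
    have "tensor_sum (coact_R \<pi> c) (\<lambda>c0 c1. L u (D c0) \<otimes> (h * c1))
        = sw c (\<lambda>c1 c2. L u (D c1) \<otimes> (h * \<pi> c2))" for u h
      unfolding coact_R_def
      by (subst tensor_sum_tensor_map) (intro lin clinear_pi | simp)+
    then show ?thesis by simp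
  qed
  finally show ?thesis .
qed

text \<open>Apply \<open>\<rho>\<close> to \<open>S(a1) da2\<close>, split \<open>S(a1)\<close> by
  \<open>sw_antipode_arg\<close>, and regroup the inner legs into \<open>\<theta>\<close>. The first
  legs of the result are again left-coinvariant.\<close>

lemma \<rho>_\<theta>: "\<rho> (\<theta> (D a)) = sw a (\<lambda>x r. sw r (\<lambda>y z. \<theta> (D y) \<otimes> (\<pi> (antipode x) * \<pi> z)))"
proof -
  let ?f = "\<lambda>x1 x2 y1 y2. L (antipode x2) (D y1) \<otimes> (\<pi> (antipode x1) * \<pi> y2)"
  have "\<rho> (\<theta> (D a)) = sw a (\<lambda>x y. sw (antipode x) (\<lambda>b1 b2. sw y (\<lambda>c1 c2. L b1 (D c1) \<otimes> (\<pi> b2 * \<pi> c2))))"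
    by (simp add: \<theta>_D tensor_sum_linear[OF clinear_\<rho>] \<rho>_form)
  also have "\<dots> = sw a (\<lambda>x y. sw x (\<lambda>x1 x2. sw y (\<lambda>y1 y2. ?f x1 x2 y1 y2)))"
    by (subst sw_antipode_arg) (intro lin | rule refl)+
  also have "\<dots> = sw a (\<lambda>x1 r. sw r (\<lambda>x2 y. sw y (\<lambda>y1 y2. ?f x1 x2 y1 y2)))"
    by (rule sw_coassoc; intro lin)
  also have "\<dots> = sw a (\<lambda>x1 r. sw r (\<lambda>y y2. sw y (\<lambda>x2 y1. ?f x1 x2 y1 y2)))"
    by (subst sw_coassoc) (intro lin | rule refl)+
  also have "\<dots> = sw a (\<lambda>x r. sw r (\<lambda>y z. \<theta> (D y) \<otimes> (\<pi> (antipode x) * \<pi> z)))"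
    by (simp add: \<theta>_D tensor_sum_linear[OF clinear_tensor_of(1)[OF clinear_ident(1)]])
  finally show ?thesis .
qed

text \<open>The coinvariant representative matters: for \<open>L a w\<close> the formula without
  \<open>sec\<close> would give \<open>[w0] \<otimes> \<pi>(a) w1\<close> instead of a multiple by
  \<open>\<epsilon>(a)\<close>.\<close>

definition AdF :: "'f \<Rightarrow> 'f \<otimes> 'h"
  where "AdF x = tensor_map qF id (\<rho> (sec x))"

lemma clinear_AdF [lin]: "clinear f \<Longrightarrow> clinear (\<lambda>x. AdF (f x))"
  unfolding AdF_def by (intro lin clinear_qF)

lemma AdF_clsF: "AdF (clsF a) = sw a (\<lambda>x r. sw r (\<lambda>y z. clsF y \<otimes> (\<pi> (antipode x) * \<pi> z)))"
proof -
  have "clinear (\<lambda>t. tensor_map qF (id :: 'h \<Rightarrow> 'h) t)" by (intro lin clinear_qF)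
  then show ?thesis
    by (simp add: AdF_def clsF_eq sec_qF \<rho>_\<theta> tensor_sum_linear[where L = "tensor_map qF id"]
        tensor_map_tensor_of clinear_qF lin qF_\<theta>)
qed

lemma AdF_coinvariant:
  assumes "b \<in> B"
  shows "AdF (clsF b) = sw b (\<lambda>x y. clsF y \<otimes> \<pi> (antipode x))"
  unfolding AdF_clsF by (subst sw3_coinvariant[OF assms]) (intro lin | simp)+

lemma AdF_coassoc: "tensor_assoc (tensor_map AdF id (AdF x)) = tensor_map id comult (AdF x)"
proof -
  obtain a where a: "x = clsF a" by (rule clsF_surj)
  let ?w = "sec x"
  have AdF: "clinear AdF" and \<theta>: "clinear \<theta>" and \<rho>q: "clinear (\<lambda>u. tensor_map qF (id :: 'h \<Rightarrow> 'h) (\<rho> u))"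
    and q: "clinear (tensor_map qF (id :: 'h \<Rightarrow> 'h))"
    using clinear_AdF[OF clinear_ident(1)] clinear_\<theta>[OF clinear_ident(1)]
      clinear_tensor_map[OF clinear_qF clinear_ident(2) clinear_ident(1)]
    by (auto intro!: lin clinear_qF)
  have w: "?w = \<theta> (D a)"
    by (simp add: a clsF_eq sec_qF)
  \<comment> \<open>The first legs are coinvariant, so passing to classes and back by
    \<open>sec\<close> changes nothing and coassociativity is inherited from
    \<open>\<rho>\<close>.\<close>
  have "tensor_map \<theta> id (\<rho> ?w) = \<rho> ?w"
    using \<theta> clinear_tensor_map[OF \<theta> clinear_ident(2) clinear_ident(1)]
    by (simp add: w \<rho>_\<theta> tensor_sum_linear[where L = "tensor_map \<theta> id"] tensor_map_tensor_of lin \<theta>_\<theta>)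
  then have "tensor_map AdF id (AdF x) = tensor_map (\<lambda>u. tensor_map qF id (\<rho> u)) id (\<rho> ?w)"
    using tensor_map_tensor_map[OF \<theta> clinear_ident(2) \<rho>q clinear_ident(2), of "\<rho> ?w"]
      tensor_map_tensor_map[OF clinear_qF clinear_ident(2) AdF clinear_ident(2), of "\<rho> ?w"]
    by (simp add: AdF_def sec_qF)
  also have "\<dots> = tensor_map (tensor_map qF id) id (tensor_map \<rho> id (\<rho> ?w))"
    using tensor_map_tensor_map[OF clinear_\<rho> clinear_ident(2) q clinear_ident(2), of "\<rho> ?w"]
    by (simp add: id_def)
  finally have "tensor_assoc (tensor_map AdF id (AdF x)) = tensor_map qF (tensor_map id id) (tensor_map id comult (\<rho> ?w))"
    by (simp add: tensor_assoc_natural clinear_qF lin \<rho>_coassoc)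
  also have "\<dots> = tensor_map id comult (tensor_map qF id (\<rho> ?w))"
    by (simp add: tensor_map_tensor_map clinear_qF clinear_comult lin
        tensor_map_ident[folded id_def])
  finally show ?thesis by (simp add: AdF_def)
qed

lemma AdF_counit: "tensor_sum (AdF x) (\<lambda>y h. counit h *\<^sub>C y) = x"
proof -
  obtain w where w: "x = qF w" by (metis surj_qF surj_def)
  have "tensor_sum (AdF x) (\<lambda>y h. counit h *\<^sub>C y) = tensor_sum (\<rho> (sec x)) (\<lambda>u h. qF (counit h *\<^sub>C u))"
    unfolding AdF_def
    by (subst tensor_sum_tensor_map) (intro lin clinear_qF | simp add: clinear_scale[OF clinear_qF])+
  also have "\<dots> = qF (sec x)"
    by (simp add: tensor_sum_linear[OF clinear_qF, symmetric] \<rho>_counit)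
  finally show ?thesis by (simp add: w sec_qF qF_\<theta>)
qed

end

section \<open>The restricted calculus\<close>

locale restricted_bundle = principal_bundle \<pi> \<Omega> \<delta> \<rho> qF
  for \<pi> :: "'a::hopf_algebra \<Rightarrow> 'h::hopf_algebra"
    and \<Omega> :: "('a, 'w::complex_vector) calculus"
    and \<delta> :: "'w \<Rightarrow> 'a \<otimes> 'w"
    and \<rho> :: "'w \<Rightarrow> 'w \<otimes> 'h"
    and qF :: "'w \<Rightarrow> 'f::complex_vector" +
  fixes qPhi :: "'w \<Rightarrow> 'v::complex_vector"
  assumes inj_antipode: "inj (antipode :: 'h \<Rightarrow> 'h)"
    and flat: "faithfully_flat B"
    and Phi: "is_Phi \<Omega> B (restricted_forms \<Omega> B) qPhi"
    and submodule: "\<forall>x\<in>range (iota \<Omega> B qPhi qF). \<forall>a. F_act \<Omega> qF x a \<in> range (iota \<Omega> B qPhi qF)"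
    and in_Mod0: "in_ABMod_0 \<Omega> \<delta> B (restricted_forms \<Omega> B)"
begin

abbreviation OB where "OB \<equiv> restricted_forms \<Omega> B"
abbreviation BO where "BO \<equiv> left_prod \<Omega> (aug_part B) OB"
abbreviation \<iota> where "\<iota> \<equiv> iota \<Omega> B qPhi qF"
abbreviation clsV where "clsV \<equiv> cls \<Omega> qPhi"

lemma OB_subspace: "csubspace OB"
  and L_OB: "b \<in> B \<Longrightarrow> w \<in> OB \<Longrightarrow> L b w \<in> OB"
  and \<delta>_OB: "w \<in> OB \<Longrightarrow> \<delta> w \<in> tensor_subspace UNIV OB"
  and BO_right: "BO = right_prod \<Omega> OB (aug_part B)"
  using in_Mod0 unfolding in_ABMod_0_def in_ABMod_B_def by auto

lemma form_OB: "a \<in> B \<Longrightarrow> b \<in> B \<Longrightarrow> L a (D b) \<in> OB"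
  unfolding restricted_forms_def by (rule complex_vector.span_base) auto

lemma D_OB: "b \<in> B \<Longrightarrow> D b \<in> OB"
  using form_OB[OF one_coinvariant, of b] by (simp add: L_one)

lemma qPhi_add: "x \<in> OB \<Longrightarrow> y \<in> OB \<Longrightarrow> qPhi (x + y) = qPhi x + qPhi y"
  and qPhi_scale: "x \<in> OB \<Longrightarrow> qPhi (c *\<^sub>C x) = c *\<^sub>C qPhi x"
  and qPhi_surj: "qPhi ` OB = UNIV"
  and qPhi_kernel: "{x \<in> OB. qPhi x = 0} = BO"
  using Phi unfolding is_Phi_def quotient_map_def by auto

lemma qPhi_diff: "x \<in> OB \<Longrightarrow> y \<in> OB \<Longrightarrow> qPhi (x - y) = qPhi x - qPhi y"
  using qPhi_add[of "x - y" y] complex_vector.subspace_diff[OF OB_subspace, of x y] by simp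

lemma qPhi_eq_iff:
  assumes "x \<in> OB" "y \<in> OB"
  shows "qPhi x = qPhi y \<longleftrightarrow> x - y \<in> BO"
proof -
  have "x - y \<in> OB"
    by (rule complex_vector.subspace_diff[OF OB_subspace assms])
  then have "x - y \<in> BO \<longleftrightarrow> qPhi (x - y) = 0"
    using qPhi_kernel by blast
  then show ?thesis by (simp only: qPhi_diff[OF assms] eq_iff_diff_eq_0[of "qPhi x"])
qed

lemma qF_left_prod:
  assumes "w \<in> left_prod \<Omega> (aug_part W) X"
  shows "qF w = 0"
proof -
  have "qF w \<in> {0}"
    by (rule cspan_linear_in[OF assms[unfolded left_prod_def] clinear_qF complex_vector.subspace_single_0])
      (auto simp: qF_L aug_part_def)
  then show ?thesis by simp
qed

text \<open>Two representatives in \<open>OB\<close> differ by an element of \<open>BO\<close>,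
  which \<open>qF\<close> kills.\<close>

lemma iota_qPhi:
  assumes "w \<in> OB"
  shows "\<iota> (qPhi w) = qF w"
proof -
  let ?w = "inv_into OB qPhi (qPhi w)"
  have "?w \<in> OB" "qPhi ?w = qPhi w"
    using assms by (auto intro: inv_into_into f_inv_into_f)
  then have "?w - w \<in> BO"
    using assms qPhi_eq_iff by blast
  then show ?thesis
    using qF_left_prod by (fastforce simp: iota_def clinear_diff[OF clinear_qF])
qed

lemma iota_clsV: "b \<in> B \<Longrightarrow> \<iota> (clsV b) = clsF b"
  by (simp add: cls_def iota_qPhi D_OB)

lemma clinear_iota: "clinear \<iota>"
proof (rule clinearI)
  fix u v c
  obtain x y where "u = qPhi x" "v = qPhi y" "x \<in> OB" "y \<in> OB"
    using qPhi_surj by (metis UNIV_I imageE)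
  then show "\<iota> (u + v) = \<iota> u + \<iota> v" "\<iota> (c *\<^sub>C u) = c *\<^sub>C \<iota> u"
    by (simp_all add: qPhi_add[symmetric] qPhi_scale[symmetric] iota_qPhi OB_subspace
        complex_vector.subspace_add complex_vector.subspace_scale
        clinear_add[OF clinear_qF] clinear_scale[OF clinear_qF])
qed

lemma clinear_iota_comp [lin]: "clinear f \<Longrightarrow> clinear (\<lambda>x. \<iota> (f x))"
  by (rule clinear_compose[OF clinear_iota])

lemma D_one: "D 1 = 0"
  using D_mult[of 1 1] by (simp add: L_one R_one)

lemma D_aug: "D (aug b) = D b"
  by (simp add: aug_def clinear_diff[OF clinear_D] clinear_scale[OF clinear_D] D_one)

lemma aug_part_subspace: "csubspace (aug_part B)"
  using csubspace_coinvariants unfolding aug_part_def complex_vector.subspace_def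
  by (auto simp: clinear_add[OF clinear_counit] clinear_scale[OF clinear_counit] clinear_zero[OF clinear_counit]
      scaleC_complex_def)

lemma BO_subspace: "csubspace BO"
  unfolding left_prod_def by (rule csubspace_cspan)

text \<open>Modulo \<open>BO\<close> the form \<open>a db\<close> equals
  \<open>\<epsilon>(a) db\<close>, and \<open>db\<close> is also the differential of
  \<open>aug b\<close>.\<close>

lemma clsV_surj:
  obtains b where "b \<in> aug_part B" "v = clsV b"
proof -
  obtain w where w: "w \<in> OB" "v = qPhi w"
    using qPhi_surj by (metis UNIV_I imageE)
  have "\<exists>b\<in>aug_part B. w - D b \<in> BO"
    using w(1) unfolding restricted_forms_def[of \<Omega> B]
  proof (induction rule: complex_vector.span_induct_alt)
    case base
    show ?case
      using complex_vector.subspace_0[OF aug_part_subspace] complex_vector.subspace_0[OF BO_subspace]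
      by (intro bexI[of _ 0]) (simp_all add: clinear_zero[OF clinear_D] restricted_forms_def[symmetric])
  next
    case (step c x y)
    then obtain a b b' where x: "x = L a (D b)" "a \<in> B" "b \<in> B" and b': "b' \<in> aug_part B" "y - D b' \<in> BO"
      by (auto simp: restricted_forms_def[symmetric])
    have "L (aug a) (D b) = x - D (counit a *\<^sub>C aug b)"
      unfolding aug_def[of a] clinear_diff[OF cbilinearD(2)[OF L_bilinear]]
        clinear_scale[OF cbilinearD(2)[OF L_bilinear]] clinear_scale[OF clinear_D] D_aug L_one x(1) ..
    moreover have "L (aug a) (D b) \<in> BO"
      unfolding left_prod_def
      by (rule complex_vector.span_base) (use aug_coinvariant[OF x(2)] D_OB[OF x(3)] in blast)
    ultimately have "c *\<^sub>C (x - D (counit a *\<^sub>C aug b)) + (y - D b') \<in> BO"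
      using b'(2) BO_subspace by (simp add: complex_vector.subspace_add complex_vector.subspace_scale)
    then have "c *\<^sub>C x + y - D (c *\<^sub>C counit a *\<^sub>C aug b + b') \<in> BO"
      by (simp add: clinear_add[OF clinear_D] clinear_scale[OF clinear_D] algebra_simps
          complex_vector.scale_right_diff_distrib)
    moreover have "c *\<^sub>C counit a *\<^sub>C aug b + b' \<in> aug_part B"
      using aug_coinvariant[OF x(3)] b'(1) aug_part_subspace
      by (simp only: complex_vector.subspace_add complex_vector.subspace_scale)
    ultimately show ?case by (auto simp: restricted_forms_def[symmetric])
  qed
  then obtain b where b: "b \<in> aug_part B" "w - D b \<in> BO" ..
  then have "v = clsV b"
    using w qPhi_eq_iff[of w "D b"] D_OB[of b] by (simp add: cls_def aug_part_def)
  then show thesis using that b by blast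
qed

section \<open>Injectivity of \<open>\<iota>\<close>\<close>

lemma L_kernel:
  assumes "\<pi> x = 0"
  shows "L x z \<in> left_prod \<Omega> (aug_part B) UNIV"
proof -
  have "L (b * y) z \<in> left_prod \<Omega> (aug_part B) UNIV" if "b \<in> aug_part B" for b y
    unfolding L_mult left_prod_def by (rule complex_vector.span_base) (use that in blast)
  then show ?thesis
    by (intro cspan_linear_in[OF pi_kernel[OF galois assms] cbilinearD(2)[OF L_bilinear]])
      (auto simp: left_prod_def csubspace_cspan)
qed

lemma D_in_left_prod:
  assumes b: "b \<in> B" and cls: "clsF b = 0"
  shows "D b \<in> left_prod \<Omega> (aug_part B) UNIV"
proof -
  obtain g :: "'h \<Rightarrow> 'h" where g: "clinear g" "g \<circ> antipode = id"
    using complex_vector_pair.linear_injective_left_inverse[OF clinear_antipode inj_antipode] by blast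
  note lg = lin clinear_compose[OF g(1)]
  have g': "g (antipode h) = h" for h
    using g(2) by (metis comp_apply id_apply)
  have "sw b (\<lambda>x y. clsF y \<otimes> \<pi> (antipode x)) = 0"
    using AdF_coinvariant[OF b] by (simp add: cls clinear_zero[OF clinear_AdF[OF clinear_ident(1)]])
  then have "tensor_sum (sw b (\<lambda>x y. clsF y \<otimes> \<pi> (antipode x))) (\<lambda>y h. g h \<otimes> y) = 0"
    using clinear_zero[OF clinear_tensor_sum[of "\<lambda>y h. g h \<otimes> y"]] by (simp add: lg)
  \<comment> \<open>The left inverse \<open>g\<close> of the antipode of \<open>H\<close> recovers
    \<open>\<pi>(b1)\<close> from \<open>\<pi>(S(b1)) = S(\<pi>(b1))\<close>.\<close>
  then have 0: "sw b (\<lambda>x y. \<pi> x \<otimes> clsF y) = 0"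
    by (subst (asm) tensor_sum_tensor_sum, (intro lg)[1], subst (asm) tensor_sum_tensor_of)
      (intro lg | simp add: pi_antipode g')+
  \<comment> \<open>This is \<open>b1 \<otimes> [b2]\<close>, whose first legs can be taken in the
    kernel of \<open>\<pi>\<close>; \<open>form_reconstruct\<close> rebuilds \<open>db\<close> from
    it.\<close>
  let ?u = "tensor_map id qF (\<delta> (D b))"
  have "tensor_map \<pi> id ?u = tensor_sum (\<delta> (D b)) (\<lambda>x y. \<pi> x \<otimes> qF y)"
    by (subst tensor_map_tensor_map) (intro lin clinear_pi clinear_qF | simp add: tensor_map_def)+
  also have "\<dots> = 0"
    using 0 by (subst \<delta>_D) (intro lin | simp add: clsF_eq)+
  finally have u: "?u \<in> tensor_subspace {x. \<pi> x = 0} UNIV"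
    by (rule tensor_map_kernel_id[OF clinear_pi])
  have "tensor_sum ?u (\<lambda>x y. L x (sec y)) = D b"
    by (subst tensor_sum_tensor_map) (intro lin clinear_qF | simp add: sec_qF form_reconstruct)+
  moreover have "tensor_sum ?u (\<lambda>x y. L x (sec y)) \<in> left_prod \<Omega> (aug_part B) UNIV"
  proof (rule tensor_subspace_linear_in[OF u])
    show "clinear (\<lambda>u. tensor_sum u (\<lambda>x y. L x (sec y)))" by (intro lin)
    show "csubspace (left_prod \<Omega> (aug_part B) UNIV)"
      unfolding left_prod_def by (rule csubspace_cspan)
    show "tensor_sum (x \<otimes> y) (\<lambda>x y. L x (sec y)) \<in> left_prod \<Omega> (aug_part B) UNIV"
      if "x \<in> {x. \<pi> x = 0}" for x y
      using that L_kernel by (subst tensor_sum_tensor_of) (intro lin | simp)+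
  qed
  ultimately show ?thesis by simp
qed

text \<open>Flatness applied to \<open>S(w\<^sub>(\<^sub>-\<^sub>1\<^sub>)) \<otimes> w\<^sub>(\<^sub>0\<^sub>)\<close>, which vanishes in \<open>A \<otimes>\<^sub>B \<Omega>\<^sup>1(A)\<close> for \<open>w \<in> B\<^sup>+\<Omega>\<^sup>1(A)\<close>.\<close>

lemma left_prod_restrict:
  assumes w: "w \<in> OB" "w \<in> left_prod \<Omega> (aug_part B) UNIV"
  shows "w \<in> BO"
proof -
  let ?T = "\<lambda>w. tensor_map antipode id (\<delta> w)"
  have T: "clinear ?T" by (intro lin clinear_antipode)
  let ?N = "balanced B UNIV L"
  have N: "csubspace ?N" unfolding balanced_def by (rule csubspace_cspan)
  \<comment> \<open>In \<open>S(x) S(b1) \<otimes> b2 y\<close> the factor \<open>b2\<close> is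
    moved across the tensor sign; then \<open>S(b1) b2\<close> contracts to the counit of
    \<open>b\<close>, which is zero.\<close>
  have "?T (L b u) \<in> ?N" if b: "b \<in> aug_part B" for b u
  proof -
    let ?f = "\<lambda>b1 b2. tensor_sum (\<delta> u) (\<lambda>x y. (antipode x * antipode b1) \<otimes> L b2 y)"
    let ?g = "\<lambda>b1 b2. tensor_sum (\<delta> u) (\<lambda>x y. (antipode x * (antipode b1 * b2)) \<otimes> y)"
    have "?T (L b u) = sw b ?f"
      unfolding tensor_map_def by (subst \<delta>_L) (intro lin | simp add: antipode_mult)+
    moreover have "sw b ?g = 0"
    proof -
      have "sw b ?g = counit b *\<^sub>C tensor_sum (\<delta> u) (\<lambda>x y. (antipode x * 1) \<otimes> y)"
        by (rule sw_antipode(1)) (intro lin)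
      then show ?thesis using b by (simp add: aug_part_def)
    qed
    \<comment> \<open>The move is legitimate because \<open>\<Delta>(b)\<close> has its second legs
      in \<open>B\<close>.\<close>
    moreover have "tensor_sum (comult b) ?g - tensor_sum (comult b) ?f \<in> ?N"
    proof (rule tensor_subspace_linear_in[OF comult_coinvariant _ N])
      show "b \<in> B" using b by (simp add: aug_part_def)
      show "clinear (\<lambda>t. tensor_sum t ?g - tensor_sum t ?f)" by (intro lin)
      fix b1 b2 assume "b2 \<in> B"
      then have "(antipode x * antipode b1 * b2) \<otimes> y - (antipode x * antipode b1) \<otimes> L b2 y \<in> ?N" for x y
        unfolding balanced_def by (intro complex_vector.span_base) blast
      then have "?g b1 b2 - ?f b1 b2 \<in> ?N"
        by (subst tensor_sum_diff[symmetric])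
          (intro tensor_sum_in_subspace[OF N], simp add: mult.assoc)
      then show "tensor_sum (b1 \<otimes> b2) ?g - tensor_sum (b1 \<otimes> b2) ?f \<in> ?N"
        by (subst tensor_sum_tensor_of, (intro lin)[1])+
    qed
    ultimately show ?thesis
      using complex_vector.subspace_neg[OF N] by fastforce
  qed
  then have tN: "?T w \<in> ?N"
    by (intro cspan_linear_in[OF w(2)[unfolded left_prod_def] T N]) auto
  have tM: "?T w \<in> tensor_subspace UNIV OB"
  proof (rule tensor_subspace_linear_in[OF \<delta>_OB[OF w(1)] _ csubspace_tensor_subspace])
    show "clinear (tensor_map (antipode :: 'a \<Rightarrow> 'a) (id :: 'w \<Rightarrow> 'w))"
      by (rule clinear_tensor_map[OF clinear_antipode clinear_ident(2,1)])
  qed (simp add: tensor_map_tensor_of clinear_antipode lin tensor_of_in_subspace)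
  obtain e :: "'w \<Rightarrow> ('a \<Rightarrow>\<^sub>0 complex)" and r where er: "clinear e" "clinear r" "\<And>w. r (e w) = w"
    using linear_embedding_poly_mapping[OF forms_span] by metis
  have t: "?T w \<in> balanced B OB L"
    by (rule flat_balanced[OF flat L_bilinear L_one L_mult er OB_subspace L_OB tM tN])
  let ?E = "\<lambda>t. tensor_sum t (\<lambda>x y. counit x *\<^sub>C y)"
  have E: "clinear ?E" by (intro lin)
  \<comment> \<open>Applying \<open>\<epsilon> \<otimes> id\<close> sends a balancing relation over
    \<open>OB\<close> to a multiple of \<open>L (aug b) m\<close>, and sends \<open>?T w\<close> to
    \<open>w\<close>.\<close>
  have "?E ((x * b) \<otimes> m - x \<otimes> L b m) \<in> BO" if "b \<in> B" "m \<in> OB" for x b m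
  proof -
    have "?E ((x * b) \<otimes> m - x \<otimes> L b m) = (- counit x) *\<^sub>C L (aug b) m"
      unfolding clinear_diff[OF E] aug_def clinear_diff[OF cbilinearD(2)[OF L_bilinear]]
        clinear_scale[OF cbilinearD(2)[OF L_bilinear]] L_one
      by (simp add: tensor_sum_tensor_of lin counit_mult scaleC_scaleC complex_vector.scale_right_diff_distrib)
    moreover have "L (aug b) m \<in> BO"
      unfolding left_prod_def
      by (rule complex_vector.span_base) (use aug_coinvariant[OF that(1)] that(2) in blast)
    ultimately show ?thesis
      using complex_vector.subspace_scale[OF BO_subspace] by presburger
  qed
  then have "?E (?T w) \<in> BO"
    by (intro cspan_linear_in[OF t[unfolded balanced_def] E BO_subspace]) auto
  moreover have "?E (?T w) = w"
    by (subst tensor_sum_tensor_map) (intro lin clinear_antipode | simp add: counit_antipode \<delta>_counit)+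
  ultimately show ?thesis by simp
qed

text \<open>If \<open>clsV b\<close> is in the kernel, \<open>D_in_left_prod\<close> and flatness
  place \<open>db\<close> in \<open>BO\<close>, which is the kernel of \<open>qPhi\<close> on
  \<open>OB\<close>.\<close>

lemma inj_iota: "inj \<iota>"
proof -
  have *: "v = 0" if "\<iota> v = 0" for v
  proof -
    obtain b where b: "b \<in> aug_part B" "v = clsV b" by (rule clsV_surj)
    then have "b \<in> B" by (simp add: aug_part_def)
    with b that have "D b \<in> BO"
      by (intro left_prod_restrict D_in_left_prod D_OB) (simp_all add: iota_clsV)
    then show ?thesis using b qPhi_kernel by (auto simp: cls_def)
  qed
  have "u = v" if "\<iota> u = \<iota> v" for u v
    using *[of "u - v"] that by (simp add: clinear_diff[OF clinear_iota])
  then show ?thesis by (rule injI)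
qed

lemma iota_eq_iff: "\<iota> u = \<iota> v \<longleftrightarrow> u = v"
  by (rule inj_eq[OF inj_iota])

text \<open>An injective linear map has a linear left inverse. Identities over \<open>\<Phi>\<close>
  can therefore be checked in the larger fibre.\<close>

lemma tensor_map_iota_inject:
  assumes "tensor_map \<iota> id s = tensor_map \<iota> (id :: 'z \<Rightarrow> 'z::complex_vector) t"
  shows "s = t"
proof -
  obtain r where r: "clinear r" "r \<circ> \<iota> = id"
    using complex_vector_pair.linear_injective_left_inverse[OF clinear_iota inj_iota] by blast
  have "r (\<iota> v) = v" for v using r(2) by (metis comp_apply id_apply)
  then have "tensor_map r id (tensor_map \<iota> (id :: 'z \<Rightarrow> 'z) u) = u" for u
    by (simp add: tensor_map_tensor_map r(1) clinear_iota lin tensor_map_ident)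
  then show ?thesis using assms by metis
qed

subsection \<open>The coaction\<close>

text \<open>Replaces the quantification over Sweedler lists by an intertwining property:
  \<open>ad\<close> is the restriction of \<open>AdF\<close> along \<open>\<iota>\<close>.\<close>

lemma is_Ad_pi_iff: "is_Ad_pi \<pi> \<Omega> qPhi ad \<longleftrightarrow> clinear ad \<and> (\<forall>v. tensor_map \<iota> id (ad v) = AdF (\<iota> v))"
proof -
  have sum: "tensor_map \<iota> id (\<Sum>(b1, b2)\<leftarrow>ps. clsV b2 \<otimes> \<pi> (antipode b1)) = AdF (clsF b)"
    if "b \<in> B" "snd ` set ps \<subseteq> B" "comult b = (\<Sum>(b1, b2)\<leftarrow>ps. b1 \<otimes> b2)" for b ps
  proof -
    have ti: "clinear (tensor_map \<iota> (id :: 'h \<Rightarrow> 'h))"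
      by (rule clinear_tensor_map[OF clinear_iota clinear_ident(2,1)])
    have "tensor_map \<iota> id (\<Sum>(b1, b2)\<leftarrow>ps. clsV b2 \<otimes> \<pi> (antipode b1))
        = (\<Sum>(b1, b2)\<leftarrow>ps. clsF b2 \<otimes> \<pi> (antipode b1))"
      unfolding clinear_sum_list[OF ti] map_map
      by (rule arg_cong[where f = sum_list], rule map_cong[OF refl])
        (use that(2) in \<open>auto simp: tensor_map_tensor_of clinear_iota lin iota_clsV\<close>)
    also have "\<dots> = AdF (clsF b)"
      unfolding AdF_coinvariant[OF that(1)] that(3)
      by (rule tensor_sum_sum_list[symmetric]) (intro lin)
    finally show ?thesis .
  qed
  show ?thesis
  proof (intro iffI conjI allI)
    assume ad: "is_Ad_pi \<pi> \<Omega> qPhi ad"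
    then show "clinear ad" by (simp add: is_Ad_pi_def)
    fix v
    obtain b where b: "b \<in> aug_part B" "v = clsV b" by (rule clsV_surj)
    then have bB: "b \<in> B" by (simp add: aug_part_def)
    obtain ps where ps: "snd ` set ps \<subseteq> B" "comult b = (\<Sum>(b1, b2)\<leftarrow>ps. b1 \<otimes> b2)"
      by (rule tensor_subspace_UNIV_sum_list[OF comult_coinvariant[OF bB] csubspace_coinvariants])
    have "ad v = (\<Sum>(b1, b2)\<leftarrow>ps. clsV b2 \<otimes> \<pi> (antipode b1))"
      using ad b ps unfolding is_Ad_pi_def by blast
    then show "tensor_map \<iota> id (ad v) = AdF (\<iota> v)"
      using sum[OF bB ps] by (simp add: b(2) iota_clsV[OF bB])
  next
    assume ad: "clinear ad \<and> (\<forall>v. tensor_map \<iota> id (ad v) = AdF (\<iota> v))"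
    show "is_Ad_pi \<pi> \<Omega> qPhi ad"
      unfolding is_Ad_pi_def
    proof (intro conjI ballI allI impI)
      fix b ps assume b: "b \<in> aug_part B"
        and ps: "snd ` set ps \<subseteq> B \<and> comult b = (\<Sum>(b1, b2)\<leftarrow>ps. b1 \<otimes> b2)"
      then have bB: "b \<in> B" by (simp add: aug_part_def)
      show "ad (clsV b) = (\<Sum>(b1, b2)\<leftarrow>ps. clsV b2 \<otimes> \<pi> (antipode b1))"
        by (rule tensor_map_iota_inject) (use ad ps sum[OF bB] in \<open>simp add: iota_clsV[OF bB]\<close>)
    qed (use ad in blast)
  qed
qed

lemma ex1_Ad_pi: "\<exists>!ad. is_Ad_pi \<pi> \<Omega> qPhi ad"
proof (rule ex_ex1I)
  obtain r where r: "clinear r" "r \<circ> \<iota> = id"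
    using complex_vector_pair.linear_injective_left_inverse[OF clinear_iota inj_iota] by blast
  have ri: "r (\<iota> v) = v" for v using r(2) by (metis comp_apply id_apply)
  \<comment> \<open>The retraction \<open>r\<close> brings the values of \<open>AdF\<close> back to
    \<open>\<Phi>\<close>.\<close>
  define ad where "ad v = tensor_map r (id :: 'h \<Rightarrow> 'h) (AdF (\<iota> v))" for v
  have "clinear ad"
    unfolding ad_def by (intro lin r)
  moreover have "tensor_map \<iota> id (ad v) = AdF (\<iota> v)" for v
  proof -
    note l = lin clinear_compose[OF r(1)]
    obtain b where b: "b \<in> aug_part B" "v = clsV b" by (rule clsV_surj)
    then have bB: "b \<in> B" by (simp add: aug_part_def)
    have ir: "clinear (tensor_map (\<lambda>x. \<iota> (r x)) (id :: 'h \<Rightarrow> 'h))"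
      by (intro clinear_tensor_map[where h = "\<lambda>x. x"] l)
    have "tensor_map \<iota> id (ad v) = tensor_map (\<lambda>x. \<iota> (r x)) id (AdF (clsF b))"
      unfolding ad_def b(2) iota_clsV[OF bB]
      by (subst tensor_map_tensor_map) (intro l r clinear_iota | simp add: id_def)+
    also have "\<dots> = sw b (\<lambda>x y. \<iota> (r (clsF y)) \<otimes> \<pi> (antipode x))"
      by (simp add: AdF_coinvariant[OF bB] tensor_sum_linear[OF ir] tensor_map_tensor_of l)
    \<comment> \<open>The second legs of \<open>\<Delta>(b)\<close> may be taken in
      \<open>B\<close>, and on such classes \<open>r\<close> inverts \<open>\<iota>\<close>.\<close>
    also have "\<dots> = sw b (\<lambda>x y. clsF y \<otimes> \<pi> (antipode x))"
      by (rule sw_coinvariant_cong[OF bB]) (intro l | simp add: iota_clsV[symmetric] ri)+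
    finally show ?thesis by (simp add: b(2) iota_clsV[OF bB] AdF_coinvariant[OF bB])
  qed
  ultimately show "\<exists>ad. is_Ad_pi \<pi> \<Omega> qPhi ad" unfolding is_Ad_pi_iff by blast
next
  fix ad ad' assume "is_Ad_pi \<pi> \<Omega> qPhi ad" "is_Ad_pi \<pi> \<Omega> qPhi ad'"
  then show "ad = ad'"
    unfolding is_Ad_pi_iff by (intro ext tensor_map_iota_inject) simp
qed

lemma right_coaction_Ad_pi:
  assumes "is_Ad_pi \<pi> \<Omega> qPhi ad"
  shows "right_coaction ad"
proof -
  have ad: "clinear ad" and iad: "tensor_map \<iota> id (ad v) = AdF (\<iota> v)" for v
    using assms by (auto simp: is_Ad_pi_iff)
  have AdF: "clinear AdF" by (intro lin)
  have i: "clinear (tensor_map \<iota> (id :: 'h \<Rightarrow> 'h))"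
    by (rule clinear_tensor_map[OF clinear_iota clinear_ident(2,1)])
  have "tensor_assoc (tensor_map ad id (ad v)) = tensor_map id comult (ad v)" for v
  proof (rule tensor_map_iota_inject)
    have "tensor_map \<iota> id (tensor_assoc (tensor_map ad id (ad v)))
        = tensor_assoc (tensor_map (tensor_map \<iota> id) id (tensor_map ad id (ad v)))"
      by (simp add: tensor_assoc_natural clinear_iota lin tensor_map_id)
    also have "tensor_map (tensor_map \<iota> id) id (tensor_map ad id (ad v)) = tensor_map AdF id (tensor_map \<iota> id (ad v))"
      unfolding tensor_map_tensor_map[OF ad clinear_ident(2) i clinear_ident(2)]
        tensor_map_tensor_map[OF clinear_iota clinear_ident(2) AdF clinear_ident(2)] by (simp only: iad)
    also have "tensor_assoc \<dots> = tensor_map id comult (tensor_map \<iota> id (ad v))"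
      by (simp add: iad AdF_coassoc)
    also have "\<dots> = tensor_map \<iota> id (tensor_map id comult (ad v))"
      by (simp add: tensor_map_tensor_map clinear_comult clinear_iota lin)
    finally show "tensor_map \<iota> id (tensor_assoc (tensor_map ad id (ad v))) = tensor_map \<iota> id (tensor_map id comult (ad v))" .
  qed
  moreover have "tensor_sum (ad v) (\<lambda>w h. counit h *\<^sub>C w) = v" for v
  proof -
    have "\<iota> (tensor_sum (ad v) (\<lambda>w h. counit h *\<^sub>C w)) = tensor_sum (tensor_map \<iota> id (ad v)) (\<lambda>w h. counit h *\<^sub>C w)"
      by (subst tensor_sum_tensor_map)
        (intro lin clinear_iota | simp add: tensor_sum_linear[OF clinear_iota] clinear_scale[OF clinear_iota])+
    then show ?thesis by (simp add: iad AdF_counit iota_eq_iff)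
  qed
  ultimately show ?thesis using ad by (simp add: right_coaction_def)
qed

subsection \<open>The action\<close>

text \<open>The kernel of \<open>\<pi>\<close> is spanned by products \<open>c x\<close> with
  \<open>c\<close> in \<open>aug_part B\<close>. Acting by \<open>c\<close> gives zero because
  \<open>right_prod \<Omega> OB (aug_part B)\<close> equals \<open>BO\<close>.\<close>

lemma actF_kernel:
  assumes "\<pi> a = 0"
  shows "actF (\<iota> v) a = 0"
proof -
  obtain b where b: "b \<in> aug_part B" "v = clsV b" by (rule clsV_surj)
  then have bB: "b \<in> B" by (simp add: aug_part_def)
  have "actF (\<iota> v) (c * x) \<in> {0}" if "c \<in> aug_part B" for c x
  proof -
    have "R (D b) c \<in> BO"
      unfolding BO_right right_prod_def
      by (rule complex_vector.span_base) (use D_OB[OF bB] that in blast)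
    then have "actF (\<iota> v) c = 0"
      by (simp add: b(2) iota_clsV[OF bB] clsF_eq actF_qF qF_left_prod)
    then show ?thesis
      by (simp add: actF_mult clinear_zero[OF cbilinearD(2)[OF actF_bilinear]])
  qed
  then have "actF (\<iota> v) a \<in> {0}"
    by (intro cspan_linear_in[OF pi_kernel[OF galois assms] cbilinearD(1)[OF actF_bilinear]
          complex_vector.subspace_single_0]) auto
  then show ?thesis by simp
qed

lemma actF_cong: "\<pi> a = \<pi> a' \<Longrightarrow> actF (\<iota> v) a = actF (\<iota> v) a'"
  using actF_kernel[of "a - a'" v]
  by (simp add: clinear_diff[OF clinear_pi] clinear_diff[OF cbilinearD(1)[OF actF_bilinear]])

lemma ex1_action: "\<exists>!v'. \<iota> v' = actF (\<iota> v) a"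
proof -
  have "actF (\<iota> v) a \<in> range \<iota>" using submodule by blast
  then show ?thesis by (auto simp: iota_eq_iff)
qed

abbreviation act where "act \<equiv> splitting_action \<Omega> B qPhi qF"

lemma iota_act: "\<iota> (act i v h) = actF (\<iota> v) (i h)"
  unfolding splitting_action_def by (rule theI'[OF ex1_action])

text \<open>Both \<open>i (\<pi> a)\<close> and \<open>a\<close> lie over \<open>\<pi> a\<close>.
  This removes the splitting from all later computations and gives independence of its
  choice.\<close>

lemma iota_act_pi:
  assumes "bicovariant_splitting \<pi> i"
  shows "\<iota> (act i v (\<pi> a)) = actF (\<iota> v) a"
  unfolding iota_act
  by (rule actF_cong) (use assms in \<open>simp add: bicovariant_splitting_def fun_eq_iff\<close>)

lemma splitting_surj:
  assumes "bicovariant_splitting \<pi> i"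
  obtains a where "h = \<pi> a"
  using assms unfolding bicovariant_splitting_def by (metis comp_apply id_apply)

lemma act_independent:
  assumes "bicovariant_splitting \<pi> i" "bicovariant_splitting \<pi> j"
  shows "act i = act j"
proof (intro ext)
  fix v h
  obtain a where "h = \<pi> a" by (rule splitting_surj[OF assms(1)])
  then show "act i v h = act j v h"
    by (simp add: iota_eq_iff[symmetric] iota_act_pi assms)
qed

lemma right_action_act:
  assumes i: "bicovariant_splitting \<pi> i"
  shows "right_action (act i)"
proof -
  have li: "clinear i" using i by (simp add: bicovariant_splitting_def)
  note l = lin clinear_compose[OF li]
  have "cbilinear (act i)"
  proof (rule cbilinearI)
    fix v
    have "clinear (\<lambda>h. \<iota> (act i v h))" unfolding iota_act by (intro l li)
    then show "clinear (\<lambda>h. act i v h)"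
      by (simp add: clinear_iff clinear_add[OF clinear_iota, symmetric] clinear_scale[OF clinear_iota, symmetric]
          iota_eq_iff)
  next
    fix h
    have "clinear (\<lambda>v. \<iota> (act i v h))" unfolding iota_act by (intro l)
    then show "clinear (\<lambda>v. act i v h)"
      by (simp add: clinear_iff clinear_add[OF clinear_iota, symmetric] clinear_scale[OF clinear_iota, symmetric]
          iota_eq_iff)
  qed
  moreover have "act i v 1 = v" for v
    using iota_act_pi[OF i, of v 1] by (simp add: pi_one actF_one iota_eq_iff)
  moreover have "act i (act i v h) k = act i v (h * k)" for v h k
  proof -
    \<comment> \<open>A splitting is in general not multiplicative; arbitrary preimages serve
      instead, since \<open>a * c\<close> lies over \<open>h * k\<close>.\<close>
    obtain a c where "h = \<pi> a" "k = \<pi> c" by (metis splitting_surj[OF i])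
    then have "\<iota> (act i (act i v h) k) = \<iota> (act i v (h * k))"
      by (simp add: iota_act_pi[OF i] pi_mult[symmetric] actF_mult del: pi_mult)
    then show ?thesis by (simp add: iota_eq_iff)
  qed
  ultimately show ?thesis by (simp add: right_action_def)
qed

lemma iota_act_clsV:
  assumes "b \<in> aug_part B"
  shows "\<iota> (act i (clsV b) h) = clsF (b * i h)"
  using assms by (simp add: iota_act iota_clsV actF_clsF aug_part_def)

text \<open>Both sides of the compatibility condition on \<open>[b] \<otimes> \<pi>(a)\<close> equal
  \<open>[b\<^sub>(\<^sub>2\<^sub>) a\<^sub>(\<^sub>1\<^sub>)] \<otimes> \<pi>(S(b\<^sub>(\<^sub>1\<^sub>)) a\<^sub>(\<^sub>2\<^sub>))\<close>.\<close>

lemma yetter_drinfeld_act: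
  assumes i: "bicovariant_splitting \<pi> i" and "is_Ad_pi \<pi> \<Omega> qPhi ad"
  shows "yetter_drinfeld (act i) ad"
proof -
  have ad: "clinear ad" and iad: "tensor_map \<iota> id (ad v) = AdF (\<iota> v)" for v
    using assms(2) by (auto simp: is_Ad_pi_iff)
  have ra: "right_action (act i)" by (rule right_action_act[OF i])
  then have bil: "cbilinear (act i)" by (simp add: right_action_def)
  note l = lin clinear_compose[OF ad] clinear_compose[OF cbilinearD(1)[OF bil]] clinear_compose[OF cbilinearD(2)[OF bil]]
  have ti: "clinear (tensor_map \<iota> (id :: 'h \<Rightarrow> 'h))"
    by (rule clinear_tensor_map[OF clinear_iota clinear_ident(2,1)])
  have ti_of: "tensor_map \<iota> id (v \<otimes> h) = \<iota> v \<otimes> h" for v and h :: 'h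
    by (simp add: tensor_map_tensor_of clinear_iota lin)
  have "tensor_sum (ad v) (\<lambda>v0 v1. sw h (\<lambda>h1 h2. act i v0 h1 \<otimes> (v1 * h2))) =
        sw h (\<lambda>h1 h2. tensor_sum (ad (act i v h2)) (\<lambda>w0 w1. w0 \<otimes> (h1 * w1)))" (is "?lhs = ?rhs") for v h
  proof (rule tensor_map_iota_inject)
    obtain b where b: "b \<in> aug_part B" "v = clsV b" by (rule clsV_surj)
    then have bB: "b \<in> B" and b0: "counit b = 0" by (auto simp: aug_part_def)
    obtain a where a: "h = \<pi> a" by (rule splitting_surj[OF i])
    let ?M = "sw b (\<lambda>b1 b2. sw a (\<lambda>a1 a2. clsF (b2 * a1) \<otimes> (\<pi> (antipode b1) * \<pi> a2)))"
    have "tensor_map \<iota> id ?lhs = tensor_sum (ad v) (\<lambda>v0 v1. sw a (\<lambda>a1 a2. actF (\<iota> v0) a1 \<otimes> (v1 * \<pi> a2)))"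
      unfolding a
      by (subst sw_pi) (intro l | simp add: tensor_sum_linear[OF ti] ti_of iota_act_pi[OF i])+
    also have "\<dots> = tensor_sum (tensor_map \<iota> id (ad v)) (\<lambda>y v1. sw a (\<lambda>a1 a2. actF y a1 \<otimes> (v1 * \<pi> a2)))"
      by (subst tensor_sum_tensor_map) (intro l clinear_iota | simp)+
    also have "\<dots> = sw b (\<lambda>b1 b2. sw a (\<lambda>a1 a2. actF (clsF b2) a1 \<otimes> (\<pi> (antipode b1) * \<pi> a2)))"
      unfolding iad b(2) iota_clsV[OF bB] AdF_coinvariant[OF bB]
      by (subst tensor_sum_tensor_sum, (intro l)[1], subst tensor_sum_tensor_of) (intro l | simp)+
    \<comment> \<open>The legs \<open>b2\<close> lie in \<open>B\<close> but not necessarily in the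
      augmentation ideal, so the Leibniz correction appears.\<close>
    also have "\<dots> = ?M - sw b (\<lambda>b1 b2. counit b2 *\<^sub>C sw a (\<lambda>a1 a2. clsF a1 \<otimes> (\<pi> (antipode b1) * \<pi> a2)))"
      by (simp add: actF_clsF clinear_diff[OF clinear_tensor_of(1)[OF clinear_ident(1)]] tensor_sum_diff
          tensor_of_bilinear tensor_sum_linear[OF clinear_scaleC(1)[OF clinear_ident(1)]])
    also have "sw b (\<lambda>b1 b2. counit b2 *\<^sub>C sw a (\<lambda>a1 a2. clsF a1 \<otimes> (\<pi> (antipode b1) * \<pi> a2)))
        = sw a (\<lambda>a1 a2. clsF a1 \<otimes> (\<pi> (antipode b) * \<pi> a2))"
      by (rule sw_counit(2)) (intro l)
    \<comment> \<open>Here \<open>\<pi>(S(b)) = S(\<epsilon>(b) 1)\<close>, and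
      \<open>\<epsilon>(b) = 0\<close>.\<close>
    also have "\<dots> = 0"
      by (simp add: pi_antipode pi_coinvariant[OF bB] b0 clinear_zero[OF clinear_antipode]
          clinear_zero[OF clinear_tensor_of(2)[OF clinear_ident(1)]] tensor_sum_zero)
    finally have lhs: "tensor_map \<iota> id ?lhs = ?M" by (simp only: diff_zero)
    have "tensor_map \<iota> id ?rhs = sw a (\<lambda>a1 a2. tensor_sum (ad (act i v (\<pi> a2))) (\<lambda>w0 w1. \<iota> w0 \<otimes> (\<pi> a1 * w1)))"
      unfolding a by (subst sw_pi) (intro l | simp add: tensor_sum_linear[OF ti] ti_of)+
    also have "\<dots> = sw a (\<lambda>a1 a2. tensor_sum (tensor_map \<iota> id (ad (act i v (\<pi> a2)))) (\<lambda>y w1. y \<otimes> (\<pi> a1 * w1)))"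
      by (subst tensor_sum_tensor_map) (intro l clinear_iota | simp)+
    also have "\<dots> = sw a (\<lambda>a1 r. tensor_sum (AdF (clsF (b * r))) (\<lambda>y w1. y \<otimes> (\<pi> a1 * w1)))"
      by (simp add: iad iota_act_pi[OF i] b(2) iota_clsV[OF bB] actF_clsF b0)
    also have "\<dots> = sw a (\<lambda>a1 r. sw (b * r) (\<lambda>u1 t. sw t (\<lambda>u2 u3. clsF u2 \<otimes> (\<pi> a1 * (\<pi> (antipode u1) * \<pi> u3)))))"
      unfolding AdF_clsF
      by (subst tensor_sum_tensor_sum, (intro l)[1], subst tensor_sum_tensor_sum, (intro l)[1],
          subst tensor_sum_tensor_of) (intro l | simp)+
    also have "\<dots> = sw a (\<lambda>a1 r. sw b (\<lambda>b1 s. sw r (\<lambda>a2 q. sw (s * q) (\<lambda>u2 u3.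
        clsF u2 \<otimes> (\<pi> a1 * (\<pi> (antipode (b1 * a2)) * \<pi> u3))))))"
      by (subst sw_mult) (intro l | rule refl)+
    also have "\<dots> = sw a (\<lambda>a1 r. sw b (\<lambda>b1 s. sw r (\<lambda>a2 q. sw s (\<lambda>b2 b3. sw q (\<lambda>a3 a4.
        clsF (b2 * a3) \<otimes> (\<pi> (a1 * antipode a2) * (\<pi> (antipode b1) * (\<pi> b3 * \<pi> a4))))))))"
      by (subst sw_mult) (intro l | simp add: antipode_mult pi_mult mult.assoc)+
    also have "\<dots> = sw a (\<lambda>a1 r. sw r (\<lambda>a2 q. sw b (\<lambda>b1 s. sw s (\<lambda>b2 b3. sw q (\<lambda>a3 a4.
        clsF (b2 * a3) \<otimes> (\<pi> (a1 * antipode a2) * (\<pi> (antipode b1) * (\<pi> b3 * \<pi> a4))))))))"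
      by (subst tensor_sum_swap) simp
    \<comment> \<open>The leg \<open>b3\<close> enters only through \<open>\<pi>\<close>, so
      coinvariance of \<open>b\<close> replaces it by \<open>1\<close>; afterwards
      \<open>a1 S(a2)\<close> contracts.\<close>
    also have "\<dots> = sw a (\<lambda>a1 r. sw r (\<lambda>a2 q. sw b (\<lambda>b1 b2. sw q (\<lambda>a3 a4.
        clsF (b2 * a3) \<otimes> (\<pi> (a1 * antipode a2) * (\<pi> (antipode b1) * (1 * \<pi> a4)))))))"
      by (subst sw3_coinvariant[OF bB]) (intro l | rule refl)+
    also have "\<dots> = sw b (\<lambda>b1 b2. sw a (\<lambda>a3 a4.
        clsF (b2 * a3) \<otimes> (\<pi> 1 * (\<pi> (antipode b1) * (1 * \<pi> a4)))))"
      by (rule sw_antipode_cancel(2)[where f = "\<lambda>x q. sw b (\<lambda>b1 b2. sw q (\<lambda>a3 a4.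
        clsF (b2 * a3) \<otimes> (\<pi> x * (\<pi> (antipode b1) * (1 * \<pi> a4)))))"]) (intro l)+
    also have "\<dots> = ?M" by (simp add: pi_one)
    finally show "tensor_map \<iota> id ?lhs = tensor_map \<iota> id ?rhs" using lhs by (simp only:)
  qed
  then show ?thesis
    using ra right_coaction_Ad_pi[OF assms(2)] by (simp add: yetter_drinfeld_def)
qed

end

theorem theorem3p3:
  fixes \<pi> :: "'a::hopf_algebra \<Rightarrow> 'h::hopf_algebra"
    and \<Omega> :: "('a, 'w::complex_vector) calculus"
    and \<delta> :: "'w \<Rightarrow> 'a \<otimes> 'w"
    and \<rho> :: "'w \<Rightarrow> 'w \<otimes> 'h"
    and qF :: "'w \<Rightarrow> 'f::complex_vector"
    and qPhi :: "'w \<Rightarrow> 'v::complex_vector"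
  assumes bij_antipodes: "bij (antipode :: 'a \<Rightarrow> 'a)" "bij (antipode :: 'h \<Rightarrow> 'h)"
    and hom: "hopf_algebra_hom \<pi>" "surj \<pi>"
    and flat: "faithfully_flat (coinvariants \<pi>)"
    and qpb: "quantum_principal_bundle \<pi> \<Omega> \<delta> \<rho>"
    and F: "is_F \<Omega> qF"
    and Phi: "is_Phi \<Omega> (coinvariants \<pi>) (restricted_forms \<Omega> (coinvariants \<pi>)) qPhi"
    and submodule: "\<forall>x\<in>range (iota \<Omega> (coinvariants \<pi>) qPhi qF). \<forall>a.
          F_act \<Omega> qF x a \<in> range (iota \<Omega> (coinvariants \<pi>) qPhi qF)"
    and in_Mod0: "in_ABMod_0 \<Omega> \<delta> (coinvariants \<pi>) (restricted_forms \<Omega> (coinvariants \<pi>))"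
    and finite_dim: "\<exists>T. finite T \<and> cspan T = (UNIV :: 'v set)"
  shows
    "(\<forall>i. bicovariant_splitting \<pi> i \<longrightarrow>
        (\<forall>v h. \<exists>!v'. iota \<Omega> (coinvariants \<pi>) qPhi qF v' =
                      F_act \<Omega> qF (iota \<Omega> (coinvariants \<pi>) qPhi qF v) (i h)) \<and>
        right_action (splitting_action \<Omega> (coinvariants \<pi>) qPhi qF i) \<and>
        (\<forall>b\<in>aug_part (coinvariants \<pi>). \<forall>h.
           iota \<Omega> (coinvariants \<pi>) qPhi qF
             (splitting_action \<Omega> (coinvariants \<pi>) qPhi qF i (cls \<Omega> qPhi b) h)
           = cls \<Omega> qF (b * i h))) \<and>
     (\<exists>!ad. is_Ad_pi \<pi> \<Omega> qPhi ad) \<and>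
     (\<forall>i ad. bicovariant_splitting \<pi> i \<and> is_Ad_pi \<pi> \<Omega> qPhi ad \<longrightarrow>
        yetter_drinfeld (splitting_action \<Omega> (coinvariants \<pi>) qPhi qF i) ad) \<and>
     (\<forall>i j. bicovariant_splitting \<pi> i \<and> bicovariant_splitting \<pi> j \<longrightarrow>
        splitting_action \<Omega> (coinvariants \<pi>) qPhi qF i =
        splitting_action \<Omega> (coinvariants \<pi>) qPhi qF j)"
proof -
  interpret restricted_bundle \<pi> \<Omega> \<delta> \<rho> qF qPhi
    by unfold_locales (fact hom(1) qpb F bij_is_inj[OF bij_antipodes(2)] flat Phi submodule in_Mod0)+
  show ?thesis
    by (intro conjI allI impI ballI ex1_action ex1_Ad_pi)
      (auto intro: right_action_act yetter_drinfeld_act act_independent simp: iota_act_clsV)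
qed

end
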